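(* Let $M$ be a gammoid that admits a $C^O$-free presentation. Then every minor of $M$ is a gammoid that admits a $C^O$-free presentation. That is, the class of $C^O$-free gammoids is closed under taking minors.
   Context: Matroids may be infinite, in the sense of Bruhn et al.: a matroid on a ground set $E$ is a family $\mathcal I\subseteq 2^E$ satisfying (I1) $\emptyset\in\mathcal I$; (I2) closure under subsets; (I3) for every non-maximal $I\in\mathcal I$ and maximal $I'\in\mathcal I$ there is $x\in I'\setminus I$ with $I\cup\{x\}\in\mathcal I$; (IM) whenever $I\in\mathcal I$ and $I\subseteq X\subseteq E$, the set $\{I'\in\mathcal I: I\subseteq I'\subseteq X\}$ has a maximal element. Minors (deletion/contraction) are the usual ones. Digraphs have no loops or parallel edges; paths and rays (one-way infinite paths) are directed forwards. A dimaze $(D,B_0)$ is a digraph $D$ with vertex set $V$ together with a set $B_0\subseteq V$ of sinks, called exits. A linkage is a set of vertex-disjoint finite directed paths each ending in $B_0$; $A\subseteq V$ is linkable if there is a linkage whose set of initial vertices is exactly $A$. $M_L(D,B_0)$ denotes the pair of $V$ and the set of linkable subsets. A strict gammoid is a matroid isomorphic to some $M_L(D,B_0)$; a gammoid is a matroid restriction of a strict gammoid. A presentation of a gammoid $M$ is a dimaze $(D,B_0)$ with $M=M_L(D,B_0)|X$ for some $X\subseteq V$. A dimaze $(D,B_0)$ contains $(D',B_0')$ if $D'$ is a subdigraph of $D$ and $B_0'\subseteq B_0$. A dimaze $(D',B_0')$ is a subdivision of $(D,B_0)$ if it is obtained as follows: add a new vertex $b_0$ and edges $(b,b_0)$ for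 all $b\in B_0$, subdivide edges of the resulting digraph to obtain $D''$, and let $B_0'$ be the in-neighbourhood of $b_0$ in $D''$ and $D'=D''-b_0$. The dimaze $C^O$ has vertices $x_i$ ($i\ge1$) and $y_i$ ($i\ge2$), edges $(x_i,x_{i+1})$ for $i\ge1$ and $(x_i,y_i)$ for $i\ge2$, and exits $\{y_i:i\ge2\}$. A dimaze is $C^O$-free if it contains no subdimaze isomorphic to a subdivision of $C^O$; a gammoid is $C^O$-free if it admits a $C^O$-free presentation. *)

theory Defs
  imports Complex_Main "Graph_Theory.Graph_Theory"
begin

section \<open>Infinite matroids\<close>

text \<open>A pair (ground set, family of independent sets), not necessarily a matroid.\<close>

type_synonym 'a indep_system = "'a set \<times> 'a set set"

abbreviation ground :: "'a indep_system \<Rightarrow> 'a set" where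
  "ground \<equiv> fst"

abbreviation indeps :: "'a indep_system \<Rightarrow> 'a set set" where
  "indeps \<equiv> snd"

definition maximal_in :: "'a set set \<Rightarrow> 'a set \<Rightarrow> bool" where
  "maximal_in F I \<longleftrightarrow> I \<in> F \<and> (\<forall>J\<in>F. I \<subseteq> J \<longrightarrow> J = I)"

definition matroid :: "'a indep_system \<Rightarrow> bool" where
  "matroid M \<longleftrightarrow>
     indeps M \<subseteq> Pow (ground M) \<and>
     {} \<in> indeps M \<and>
     (\<forall>I\<in>indeps M. \<forall>J. J \<subseteq> I \<longrightarrow> J \<in> indeps M) \<and>
     (\<forall>I I'. I \<in> indeps M \<and> \<not> maximal_in (indeps M) I \<and> maximal_in (indeps M) I' \<longrightarrow>
        (\<exists>x\<in>I' - I. insert x I \<in> indeps M)) \<and>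
     (\<forall>I X. I \<in> indeps M \<and> I \<subseteq> X \<and> X \<subseteq> ground M \<longrightarrow>
        (\<exists>J. maximal_in {I' \<in> indeps M. I \<subseteq> I' \<and> I' \<subseteq> X} J))"

definition bases :: "'a indep_system \<Rightarrow> 'a set set" where
  "bases M = {B. maximal_in (indeps M) B}"

definition restriction :: "'a indep_system \<Rightarrow> 'a set \<Rightarrow> 'a indep_system" where
  "restriction M X = (X, {I \<in> indeps M. I \<subseteq> X})"

definition deletion :: "'a indep_system \<Rightarrow> 'a set \<Rightarrow> 'a indep_system" where
  "deletion M X = restriction M (ground M - X)"

text \<open>The bases of the dual are the complements of the bases.\<close>

definition dual :: "'a indep_system \<Rightarrow> 'a indep_system" where
  "dual M = (ground M, {I. \<exists>B\<in>bases M. I \<subseteq> ground M - B})"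

definition contraction :: "'a indep_system \<Rightarrow> 'a set \<Rightarrow> 'a indep_system" where
  "contraction M X = dual (deletion (dual M) X)"

definition is_minor :: "'a indep_system \<Rightarrow> 'a indep_system \<Rightarrow> bool" where
  "is_minor N M \<longleftrightarrow>
     (\<exists>C D. C \<subseteq> ground M \<and> D \<subseteq> ground M \<and> C \<inter> D = {} \<and> N = deletion (contraction M C) D)"

definition indep_system_iso :: "'a indep_system \<Rightarrow> 'b indep_system \<Rightarrow> bool" where
  "indep_system_iso M N \<longleftrightarrow>
     (\<exists>f. bij_betw f (ground M) (ground N) \<and> indeps N = (\<lambda>I. f ` I) ` indeps M)"


section \<open>Dimazes and gammoids\<close>

text \<open>Digraphs are possibly infinite: \<^locale>\<open>pair_loopfree_digraph\<close> does not
  assume finiteness, and parallel edges are excluded by the representation.\<close>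

definition dimaze :: "'v pair_pre_digraph \<Rightarrow> 'v set \<Rightarrow> bool" where
  "dimaze D B0 \<longleftrightarrow> pair_loopfree_digraph D \<and> B0 \<subseteq> pverts D \<and>
     (\<forall>b\<in>B0. \<forall>v. (b, v) \<notin> parcs D)"

text \<open>Finite directed paths are nonempty lists of distinct vertices; a path may be trivial.\<close>

definition linkage :: "'v pair_pre_digraph \<Rightarrow> 'v set \<Rightarrow> 'v list set \<Rightarrow> bool" where
  "linkage D B0 P \<longleftrightarrow>
     (\<forall>p\<in>P. vpath p (with_proj D) \<and> last p \<in> B0) \<and>
     (\<forall>p\<in>P. \<forall>q\<in>P. p \<noteq> q \<longrightarrow> set p \<inter> set q = {})"

definition linkable :: "'v pair_pre_digraph \<Rightarrow> 'v set \<Rightarrow> 'v set \<Rightarrow> bool" where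
  "linkable D B0 A \<longleftrightarrow> (\<exists>P. linkage D B0 P \<and> hd ` P = A)"

definition M_L :: "'v pair_pre_digraph \<Rightarrow> 'v set \<Rightarrow> 'v indep_system" where
  "M_L D B0 = (pverts D, {A. A \<subseteq> pverts D \<and> linkable D B0 A})"

definition strict_gammoid :: "'v indep_system \<Rightarrow> bool" where
  "strict_gammoid M \<longleftrightarrow> matroid M \<and>
     (\<exists>(D :: 'v pair_pre_digraph) B0. dimaze D B0 \<and> indep_system_iso M (M_L D B0))"

definition gammoid :: "'v indep_system \<Rightarrow> bool" where
  "gammoid M \<longleftrightarrow>
     (\<exists>L X. strict_gammoid L \<and> X \<subseteq> ground L \<and> M = restriction L X)"

definition presentation :: "'v pair_pre_digraph \<Rightarrow> 'v set \<Rightarrow> 'v indep_system \<Rightarrow> bool" where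
  "presentation D B0 M \<longleftrightarrow> dimaze D B0 \<and>
     (\<exists>X. X \<subseteq> pverts D \<and> M = restriction (M_L D B0) X)"


section \<open>Subdivisions and freeness\<close>

definition contains_dimaze ::
  "'v pair_pre_digraph \<Rightarrow> 'v set \<Rightarrow> 'v pair_pre_digraph \<Rightarrow> 'v set \<Rightarrow> bool" where
  "contains_dimaze D B0 D' B0' \<longleftrightarrow>
     subgraph (with_proj D') (with_proj D) \<and> B0' \<subseteq> B0"

definition inner_verts :: "'v list \<Rightarrow> 'v set" where
  "inner_verts p = set (tl (butlast p))"

text \<open>\<open>H\<close> arises from \<open>G\<close>, up to the renaming \<open>f\<close> of the vertices of \<open>G\<close>, by
  replacing each edge \<open>e\<close> by the path \<open>P e\<close>; infinitely many edges may be subdivided.\<close>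

definition subdivides_via ::
  "('a \<Rightarrow> 'b) \<Rightarrow> ('a \<times> 'a \<Rightarrow> 'b list) \<Rightarrow> 'b pair_pre_digraph \<Rightarrow> 'a pair_pre_digraph \<Rightarrow> bool"
where
  "subdivides_via f P H G \<longleftrightarrow>
     inj_on f (pverts G) \<and>
     (\<forall>e\<in>parcs G. vpath (P e) (with_proj H) \<and> hd (P e) = f (fst e) \<and> last (P e) = f (snd e) \<and>
        inner_verts (P e) \<inter> f ` pverts G = {}) \<and>
     (\<forall>e\<in>parcs G. \<forall>e'\<in>parcs G. e \<noteq> e' \<longrightarrow> inner_verts (P e) \<inter> inner_verts (P e') = {}) \<and>
     pverts H = f ` pverts G \<union> (\<Union>e\<in>parcs G. inner_verts (P e)) \<and>
     parcs H = (\<Union>e\<in>parcs G. set (vwalk_arcs (P e)))"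

text \<open>\<open>None\<close> is the additional vertex \<open>b\<^sub>0\<close>.\<close>

definition add_sink :: "'v pair_pre_digraph \<Rightarrow> 'v set \<Rightarrow> 'v option pair_pre_digraph" where
  "add_sink D B0 =
     \<lparr> pverts = insert None (Some ` pverts D),
       parcs = {(Some u, Some v) | u v. (u, v) \<in> parcs D} \<union> {(Some b, None) | b. b \<in> B0} \<rparr>"

text \<open>\<open>(D', B0')\<close> is isomorphic to a subdivision of \<open>(D, B0)\<close>.\<close>

definition dimaze_subdivision ::
  "'b pair_pre_digraph \<Rightarrow> 'b set \<Rightarrow> 'a pair_pre_digraph \<Rightarrow> 'a set \<Rightarrow> bool" where
  "dimaze_subdivision D' B0' D B0 \<longleftrightarrow>
     (\<exists>(D'' :: 'b option pair_pre_digraph) f P.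
        subdivides_via f P D'' (add_sink D B0) \<and> f None = None \<and>
        D' = \<lparr> pverts = {v. Some v \<in> pverts D''},
               parcs = {(u, v). (Some u, Some v) \<in> parcs D''} \<rparr> \<and>
        B0' = {v. (Some v, None) \<in> parcs D''})"

datatype CO_vertex = CO_x nat | CO_y nat

definition CO :: "CO_vertex pair_pre_digraph" where
  "CO = \<lparr> pverts = {CO_x i | i. i \<ge> 1} \<union> {CO_y i | i. i \<ge> 2},
          parcs = {(CO_x i, CO_x (i + 1)) | i. i \<ge> 1} \<union> {(CO_x i, CO_y i) | i. i \<ge> 2} \<rparr>"

definition CO_exits :: "CO_vertex set" where
  "CO_exits = {CO_y i | i. i \<ge> 2}"

definition CO_free :: "'v pair_pre_digraph \<Rightarrow> 'v set \<Rightarrow> bool" where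
  "CO_free D B0 \<longleftrightarrow>
     \<not> (\<exists>D' B0'. contains_dimaze D B0 D' B0' \<and> dimaze_subdivision D' B0' CO CO_exits)"

text \<open>A gammoid is a restriction of a strict gammoid, so the dimaze presenting it is one that
  defines a strict gammoid. The pair \<^term>\<open>M_L D B0\<close> of an arbitrary dimaze need not be a
  matroid, even if it is \<open>C\<^sup>O\<close>-free and one of its restrictions is a matroid.\<close>

definition CO_free_gammoid :: "'v indep_system \<Rightarrow> bool" where
  "CO_free_gammoid M \<longleftrightarrow> gammoid M \<and>
     (\<exists>D B0. presentation D B0 M \<and> strict_gammoid (M_L D B0) \<and> CO_free D B0)"

text \<open>The same without requiring that \<^term>\<open>M_L D B0\<close> itself is a matroid.\<close>

definition CO_free_presentable_matroid :: "'v indep_system \<Rightarrow> bool" where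
  "CO_free_presentable_matroid M \<longleftrightarrow> matroid M \<and>
     (\<exists>D B0. presentation D B0 M \<and> CO_free D B0)"

end

theory Submission
  imports Defs "HOL-Library.Infinite_Set"
begin

text \<open>
  Let \<open>X\<close> be a set of vertices of a \<open>C\<^sup>O\<close>-free dimaze and \<open>B\<close> a maximal linkable subset of \<open>X\<close>,
  linked to the exits by \<open>P\<close>. Shifting the dimaze along \<open>P\<close> turns \<open>B\<close> into exits, and deleting
  \<open>S \<subseteq> B\<close> then contracts \<open>S\<close>. Paths of the shifted dimaze are alternating walks with respect to
  \<open>P\<close>. A ray of the original dimaze whose arcs come from two linkages meets infinitely many paths
  of one of them, so it yields a subdivision of \<open>C\<^sup>O\<close>. Consequently sets linkable after the shift are
  linkable before it, and an infinite alternating walk that meets \<open>P\<close> infinitely often and starts at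
  \<open>x\<close> makes \<open>B \<union> {x}\<close> linkable. By maximality of \<open>B\<close> there is no such walk with \<open>x \<in> X\<close>. This gives
  both the converse implication for subsets of \<open>X\<close> and, once the shifted dimaze is restricted to the
  vertices reachable from \<open>X\<close>, that it is \<open>C\<^sup>O\<close>-free.
\<close>

section \<open>Linkages and rays\<close>

text \<open>No path is cut and reglued along alternating walks. Linkages become injections on the
  non-exits, and moving between the two dimazes means composing with \<open>m\<close> or dividing by
  it. Injectivity keeps orbits disjoint, and a start outside the image excludes cycles, so a linkage
  can only fail through an orbit that never reaches an exit. Such an orbit is a ray, and its trace
  on the vertex set \<open>Z\<close> of \<open>P\<close> decides the case. If the trace is finite,
  then \<open>m\<close> is the identity along a tail, and the tail follows the other injection
  alone; this is excluded because paths of a linkage are finite or, in an augmentation, because the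
  augmenting ray meets \<open>Z\<close> infinitely often. If the trace is infinite, the ray is
  impossible in the original dimaze, but in the shifted one it is only known to augment
  \<open>P\<close> from its first vertex. Maximality says nothing about a first vertex outside
  \<open>X\<close>, hence the restriction to vertices reachable from \<open>X\<close>.\<close>

lemma set_vwalk_arcs_nth: "set (vwalk_arcs p) = {(p ! i, p ! Suc i) | i. Suc i < length p}"
proof (induction p rule: vwalk_arcs.induct)
  case (3 x y xs)
  have "{((x # y # xs) ! i, (x # y # xs) ! Suc i) | i. Suc i < length (x # y # xs)} =
    insert (x, y) {((y # xs) ! i, (y # xs) ! Suc i) | i. Suc i < length (y # xs)}" (is "?L = ?R")
  proof
    show "?L \<subseteq> ?R"
    proof
      fix e assume "e \<in> ?L"
      then obtain i where "e = ((x # y # xs) ! i, (x # y # xs) ! Suc i)"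
        "Suc i < length (x # y # xs)" by blast
      then show "e \<in> ?R" by (cases i) auto
    qed
    show "?R \<subseteq> ?L"
    proof
      fix e assume "e \<in> ?R"
      then consider "e = (x, y)" | i where "e = ((y # xs) ! i, (y # xs) ! Suc i)"
        "Suc i < length (y # xs)" by blast
      then show "e \<in> ?L"
      proof cases
        case 1
        then have "e = ((x # y # xs) ! 0, (x # y # xs) ! Suc 0) \<and> Suc 0 < length (x # y # xs)" by simp
        then show ?thesis by blast
      next
        case 2
        then have "e = ((x # y # xs) ! Suc i, (x # y # xs) ! Suc (Suc i)) \<and>
          Suc (Suc i) < length (x # y # xs)" by simp
        then show ?thesis by blast
      qed
    qed
  qed
  with 3 show ?case by simp
qed auto

lemma vpath_iff_nth:
  "vpath p (with_proj D) \<longleftrightarrow> p \<noteq> [] \<and> distinct p \<and> set p \<subseteq> pverts D \<and>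
     (\<forall>i. Suc i < length p \<longrightarrow> (p ! i, p ! Suc i) \<in> parcs D)"
  by (auto simp: vpath_def vwalk_def set_vwalk_arcs_nth)

lemma vpath_append_right: "vpath (p @ q) G \<Longrightarrow> q \<noteq> [] \<Longrightarrow> vpath q G"
  by (auto simp: vpath_def intro: vwalkI_append_r)

definition ray :: "'v pair_pre_digraph \<Rightarrow> (nat \<Rightarrow> 'v) \<Rightarrow> bool" where
  "ray D r \<longleftrightarrow> inj r \<and> (\<forall>n. (r n, r (Suc n)) \<in> parcs D)"

text \<open>This reformulates the absence of a subdivision of \<open>C\<^sup>O\<close>; see \<open>CO_free_of_comb_free\<close> and
  \<open>comb_free_of_CO_free\<close>. The paths of the linkage may meet the ray again.\<close>

definition comb_free :: "'v pair_pre_digraph \<Rightarrow> 'v set \<Rightarrow> bool" where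
  "comb_free D B0 \<longleftrightarrow> (\<forall>r A. ray D r \<longrightarrow> A \<subseteq> range r \<longrightarrow> linkable D B0 A \<longrightarrow> finite A)"

lemma ray_tail: "ray D r \<Longrightarrow> ray D (\<lambda>n. r (n + k))"
  by (auto simp: ray_def intro!: injI dest: injD)

lemma finite_range_Int_tail:
  assumes "inj (r :: nat \<Rightarrow> 'v)" "finite (range r \<inter> Z)"
  obtains N where "\<And>n. n \<ge> N \<Longrightarrow> r n \<notin> Z"
proof -
  have "finite (r -` Z)"
    using finite_vimageI[OF assms(2,1)] by (rule rev_finite_subset) auto
  then obtain N where "\<forall>n\<in>r -` Z. n < N" using finite_nat_set_iff_bounded by blast
  then show ?thesis using that[of N] by (meson leD vimageI)
qed

lemma linkable_subset:
  assumes "linkable D B0 A" "A' \<subseteq> A"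
  shows "linkable D B0 A'"
proof -
  obtain P where P: "linkage D B0 P" "hd ` P = A" using assms by (auto simp: linkable_def)
  then have "linkage D B0 {p \<in> P. hd p \<in> A'}" by (auto simp: linkage_def)
  moreover have "hd ` {p \<in> P. hd p \<in> A'} = A'" using P assms(2) by auto
  ultimately show ?thesis by (auto simp: linkable_def)
qed

text \<open>Suffixes keep their exits and only lose vertices, so disjointness is inherited. This
  lets paths start at their first or at their last vertex on a ray.\<close>

lemma linkage_suffixes:
  assumes "linkage D B0 P" "P' \<subseteq> P" "\<And>p. p \<in> P' \<Longrightarrow> g p \<noteq> [] \<and> (\<exists>ys. p = ys @ g p)"
  shows "linkage D B0 (g ` P')"
proof -
  have suffix: "vpath (g p) (with_proj D)" "last (g p) \<in> B0" "set (g p) \<subseteq> set p" if p: "p \<in> P'" for p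
  proof -
    obtain ys where ys: "p = ys @ g p" "g p \<noteq> []" using assms(3)[OF p] by blast
    have p: "vpath p (with_proj D)" "last p \<in> B0" using assms(1,2) p by (auto simp: linkage_def)
    show "vpath (g p) (with_proj D)" using ys p(1) vpath_append_right by metis
    show "last (g p) \<in> B0" using ys p(2) by (metis last_appendR)
    show "set (g p) \<subseteq> set p" using ys by (metis set_append sup_ge2)
  qed
  have "set (g p) \<inter> set (g q) = {}" if "p \<in> P'" "q \<in> P'" "g p \<noteq> g q" for p q
  proof -
    have "set p \<inter> set q = {}" using assms(1,2) that unfolding linkage_def by (metis subsetD)
    then show ?thesis using suffix(3)[OF that(1)] suffix(3)[OF that(2)] by blast
  qed
  then show ?thesis unfolding linkage_def using suffix(1,2) by simp
qed

text \<open>Trimmed to start at their first vertices on the ray, the paths that meet it form a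
  linkage with distinct heads on the ray. So \<open>comb_free\<close> leaves finitely many of them,
  and each is finite.\<close>

lemma comb_free_ray_Int_linkage:
  assumes "comb_free D B0" "linkage D B0 P" "ray D r"
  shows "finite (range r \<inter> (\<Union>p\<in>P. set p))"
proof -
  define g where "g = dropWhile (\<lambda>v. v \<notin> range r)"
  define P' where "P' = {p \<in> P. set p \<inter> range r \<noteq> {}}"
  have hd: "hd (g p) \<in> range r" "g p \<noteq> []" if "p \<in> P'" for p
  proof -
    show "g p \<noteq> []" using that unfolding g_def P'_def by (auto simp: dropWhile_eq_Nil_conv)
    then show "hd (g p) \<in> range r" unfolding g_def using hd_dropWhile by fast
  qed
  have app: "\<exists>ys. p = ys @ g p" for p unfolding g_def by (metis takeWhile_dropWhile_id)
  have "linkage D B0 (g ` P')"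
    using hd app by (intro linkage_suffixes[OF assms(2)]) (auto simp: P'_def)
  then have "linkable D B0 (hd ` g ` P')" by (auto simp: linkable_def)
  moreover have "hd ` g ` P' \<subseteq> range r" using hd(1) by auto
  ultimately have "finite (hd ` g ` P')"
    using assms(1,3) unfolding comb_free_def by blast
  moreover have "inj_on (\<lambda>p. hd (g p)) P'"
  proof (rule inj_onI)
    fix p q assume pq: "p \<in> P'" "q \<in> P'" "hd (g p) = hd (g q)"
    then have "hd (g p) \<in> set p \<inter> set q"
      using hd(2) app by (metis IntI UnCI hd_in_set set_append)
    then show "p = q" using assms(2) pq(1,2) by (auto simp: linkage_def P'_def)
  qed
  ultimately have "finite P'" by (metis finite_imageD image_image)
  moreover have "range r \<inter> (\<Union>p\<in>P. set p) \<subseteq> (\<Union>p\<in>P'. set p)" by (auto simp: P'_def)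
  ultimately show ?thesis by (meson finite_UN finite_set finite_subset)
qed

text \<open>By injectivity both orbits can be traced back in step until one is at its start, which
  has no preimage. For \<open>a = b\<close> this shows that an orbit does not repeat, otherwise that
  two orbits are disjoint.\<close>

lemma orbit_unique:
  assumes "inj_on m W" "a \<notin> m ` W" "b \<notin> m ` W"
    and "\<And>k. k < i \<Longrightarrow> (m ^^ k) a \<in> W" "\<And>k. k < j \<Longrightarrow> (m ^^ k) b \<in> W"
    and "(m ^^ i) a = (m ^^ j) b"
  shows "i = j \<and> a = b"
  using assms(4-)
proof (induction i arbitrary: j)
  case 0
  then show ?case using assms(2) by (cases j) auto
next
  case (Suc i)
  show ?case
  proof (cases j)
    case 0
    then show ?thesis using Suc.prems assms(3) by auto
  next
    case (Suc j')
    have "(m ^^ i) a = (m ^^ j') b"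
      using assms(1) Suc.prems Suc by (auto dest: inj_onD)
    then show ?thesis using Suc.IH[of j'] Suc.prems Suc by auto
  qed
qed

text \<open>A linkage is encoded by the injection on the non-exits that maps a vertex on a path to its
  successor and fixes all other vertices. The values at the exits are irrelevant. Conversely, the
  orbits of such an injection starting outside its image are disjoint paths or rays.\<close>

definition matching_fun :: "'v pair_pre_digraph \<Rightarrow> 'v set \<Rightarrow> ('v \<Rightarrow> 'v) \<Rightarrow> bool" where
  "matching_fun D B0 m \<longleftrightarrow> inj_on m (pverts D - B0) \<and>
     (\<forall>v\<in>pverts D - B0. m v \<noteq> v \<longrightarrow> (v, m v) \<in> parcs D)"

section \<open>From orbits of injections to linkages and back\<close>

lemma matching_fun_in_verts:
  assumes "dimaze D B0" "matching_fun D B0 m" "v \<in> pverts D - B0"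
  shows "m v \<in> pverts D"
  using assms pair_wf_digraph.in_arcsD2[of D v "m v"]
  by (cases "m v = v") (auto simp: dimaze_def matching_fun_def pair_loopfree_digraph_def)

text \<open>An orbit that starts outside the image does not repeat, so it never rests at a fixed
  point and each of its steps is an arc.\<close>

lemma matching_fun_orbit_ray:
  assumes "dimaze D B0" "matching_fun D B0 m" "a \<in> pverts D" "a \<notin> m ` (pverts D - B0)"
    and "\<And>k. (m ^^ k) a \<notin> B0"
  shows "(m ^^ k) a \<in> pverts D - B0" "ray D (\<lambda>k. (m ^^ k) a)"
proof -
  have "(m ^^ k) a \<in> pverts D" for k
  proof (induction k)
    case (Suc k)
    then show ?case using matching_fun_in_verts[OF assms(1,2)] assms(5) by simp
  qed (use assms(3) in simp)
  then have W: "(m ^^ k) a \<in> pverts D - B0" for k using assms(5) by blast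
  then show "(m ^^ k) a \<in> pverts D - B0" .
  have inj: "inj (\<lambda>k. (m ^^ k) a)"
    using orbit_unique[of m "pverts D - B0" a a] assms(2,4) W by (auto simp: inj_def matching_fun_def)
  have "(m ^^ Suc k) a \<noteq> (m ^^ k) a" for k using inj by (metis injD n_not_Suc_n)
  then show "ray D (\<lambda>k. (m ^^ k) a)"
    using inj W assms(2) by (auto simp: ray_def matching_fun_def)
qed

text \<open>The paths are the orbits cut off at their first exits; \<open>orbit_unique\<close> makes
  each of them simple and any two disjoint.\<close>

lemma linkable_of_matching_fun:
  assumes "dimaze D B0" "matching_fun D B0 m" "A \<subseteq> pverts D" "A \<inter> m ` (pverts D - B0) = {}"
    and "\<And>a. a \<in> A \<Longrightarrow> \<exists>k. (m ^^ k) a \<in> B0"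
  shows "linkable D B0 A"
proof -
  let ?W = "pverts D - B0"
  \<comment> \<open>The first visit to an exit: before it the orbit stays in \<open>?W\<close>,
    where \<open>m\<close> is injective and moves only along arcs.\<close>
  define l where "l a = (LEAST k. (m ^^ k) a \<in> B0)" for a
  define p where "p a = map (\<lambda>k. (m ^^ k) a) [0..<Suc (l a)]" for a
  have inj: "inj_on m ?W" using assms(2) by (simp add: matching_fun_def)
  have lB: "(m ^^ l a) a \<in> B0" if "a \<in> A" for a
    unfolding l_def using LeastI_ex[OF assms(5)[OF that]] .
  have lW: "(m ^^ k) a \<in> ?W" if "a \<in> A" "k < l a" for a k
    using that(2)
  proof (induction k)
    case 0
    then show ?case using that assms(3) not_less_Least[of 0 "\<lambda>k. (m ^^ k) a \<in> B0"] by (auto simp: l_def)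
  next
    case (Suc k)
    then show ?case
      using matching_fun_in_verts[OF assms(1,2)] not_less_Least[of "Suc k" "\<lambda>k. (m ^^ k) a \<in> B0"]
      by (auto simp: l_def)
  qed
  have uniq: "i = j \<and> a = b" if "a \<in> A" "b \<in> A" "i \<le> l a" "j \<le> l b" "(m ^^ i) a = (m ^^ j) b" for a b i j
  proof (rule orbit_unique[OF inj])
    show "a \<notin> m ` ?W" "b \<notin> m ` ?W" using that(1,2) assms(4) by blast+
    show "(m ^^ k) a \<in> ?W" if "k < i" for k using lW \<open>a \<in> A\<close> \<open>i \<le> l a\<close> that by simp
    show "(m ^^ k) b \<in> ?W" if "k < j" for k using lW \<open>b \<in> A\<close> \<open>j \<le> l b\<close> that by simp
  qed fact
  have setp: "set (p a) = (\<lambda>k. (m ^^ k) a) ` {..l a}" for a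
    unfolding p_def by (simp only: set_map set_upt) (auto simp: less_Suc_eq_le)
  have nth: "p a ! k = (m ^^ k) a" if "k \<le> l a" for a k
    unfolding p_def using that by (simp del: upt_Suc)
  have len: "length (p a) = Suc (l a)" for a by (simp add: p_def)
  have "vpath (p a) (with_proj D)" if a: "a \<in> A" for a
  proof -
    have "p a \<noteq> []" using len by (metis Zero_not_Suc list.size(3))
    moreover have "inj_on (\<lambda>k. (m ^^ k) a) {..l a}"
      using uniq[OF a a] by (intro inj_onI) simp
    then have "distinct (p a)"
      unfolding p_def distinct_map set_upt by (simp add: atLeast0LessThan lessThan_Suc_atMost del: upt_Suc)
    moreover have "set (p a) \<subseteq> pverts D"
    proof -
      have "(m ^^ k) a \<in> pverts D" if "k \<le> l a" for k
      proof (cases "k = l a")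
        case True
        then show ?thesis using lB[OF a] assms(1) by (auto simp: dimaze_def)
      next
        case False
        then show ?thesis using lW[OF a, of k] that by simp
      qed
      then show ?thesis unfolding setp by (intro image_subsetI) simp
    qed
    moreover have "(p a ! i, p a ! Suc i) \<in> parcs D" if "Suc i < length (p a)" for i
    proof -
      have i: "i < l a" using that len by simp
      then have "(m ^^ Suc i) a \<noteq> (m ^^ i) a" using uniq[OF a a, of "Suc i" i] by auto
      then show ?thesis using i nth lW[OF a i] assms(2) by (auto simp: matching_fun_def)
    qed
    ultimately show ?thesis by (simp add: vpath_iff_nth)
  qed
  moreover have "last (p a) \<in> B0" if "a \<in> A" for a using lB[OF that] by (simp add: p_def)
  moreover have "set (p a) \<inter> set (p b) = {}" if "a \<in> A" "b \<in> A" "p a \<noteq> p b" for a b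
    using that uniq unfolding setp by fastforce
  ultimately have "linkage D B0 (p ` A)" by (auto simp: linkage_def)
  moreover have "hd (p a) = a" for a by (simp add: p_def hd_map upt_conv_Cons del: upt_Suc)
  then have "hd ` p ` A = A" by (simp add: image_image)
  ultimately show ?thesis by (auto simp: linkable_def)
qed

text \<open>\<open>Z\<close> is to be the vertex set of a linkage encoded by \<open>m\<close>. The
  last clause records that its paths are finite; an injection as in \<open>matching_fun\<close>
  could run along rays as well.\<close>

definition follows :: "('v \<Rightarrow> 'v) \<Rightarrow> 'v set \<Rightarrow> 'v set \<Rightarrow> 'v set \<Rightarrow> bool" where
  "follows m W B0 Z \<longleftrightarrow> (\<forall>v\<in>W - Z. m v = v) \<and> (\<forall>v\<in>Z \<inter> W. m v \<in> Z) \<and> (\<forall>v\<in>Z. \<exists>k. (m ^^ k) v \<in> B0)"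

lemma matching_fun_of_linkage:
  assumes "dimaze D B0" "linkage D B0 P"
  obtains m where "matching_fun D B0 m" "follows m (pverts D - B0) B0 (\<Union>p\<in>P. set p)"
    "hd ` P \<inter> m ` (pverts D - B0) = {}"
proof -
  let ?W = "pverts D - B0" and ?Z = "\<Union>p\<in>P. set p"
  define succs where "succs v u \<longleftrightarrow> (\<exists>p\<in>P. \<exists>i. Suc i < length p \<and> v = p ! i \<and> u = p ! Suc i)" for v u
  define m where "m v = (if v \<in> ?Z - B0 then SOME u. succs v u else v)" for v
  have path: "distinct p" "p \<noteq> []" "set p \<subseteq> pverts D" "last p \<in> B0"
    "\<And>i. Suc i < length p \<Longrightarrow> (p ! i, p ! Suc i) \<in> parcs D" if "p \<in> P" for p
    using assms(2) that by (auto simp: linkage_def vpath_iff_nth)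
  have disj: "p = q" if "p \<in> P" "q \<in> P" "v \<in> set p" "v \<in> set q" for p q v
    using assms(2) that by (auto simp: linkage_def)
  \<comment> \<open>Exits are sinks, so a path of the linkage has its exit at the end and nowhere
    else.\<close>
  have inB0: "p ! i \<notin> B0 \<longleftrightarrow> Suc i < length p" if "p \<in> P" "i < length p" for p i
  proof
    assume "p ! i \<notin> B0"
    then have "i \<noteq> length p - 1" using path(2,4)[OF that(1)] by (metis last_conv_nth)
    then show "Suc i < length p" using that(2) by simp
  next
    assume "Suc i < length p"
    then show "p ! i \<notin> B0" using path(5)[OF that(1)] assms(1) by (auto simp: dimaze_def)
  qed
  have succs_unique: "u = p ! Suc i" if p: "p \<in> P" "Suc i < length p" and su: "succs (p ! i) u" for p i u
  proof -
    obtain q j where q: "q \<in> P" "Suc j < length q" "p ! i = q ! j" "u = q ! Suc j"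
      using su by (auto simp: succs_def)
    have "q = p" using disj[of q p "p ! i"] q p by (metis Suc_lessD nth_mem)
    then show ?thesis using q p path(1) by (metis Suc_lessD nth_eq_iff_index_eq)
  qed
  have m_nth: "m (p ! i) = p ! Suc i" if "p \<in> P" "Suc i < length p" for p i
  proof -
    have "succs (p ! i) (p ! Suc i)" using that by (auto simp: succs_def)
    then have "(SOME u. succs (p ! i) u) = p ! Suc i"
      using succs_unique[OF that] by (metis someI)
    moreover have "p ! i \<in> ?Z - B0" using that inB0[of p i] by (auto intro!: bexI[of _ p])
    ultimately show ?thesis by (simp add: m_def)
  qed
  have Zcase: "\<exists>p i. p \<in> P \<and> Suc i < length p \<and> v = p ! i" if v: "v \<in> ?Z" "v \<notin> B0" for v
  proof -
    obtain p where "p \<in> P" "v \<in> set p" using v(1) by auto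
    then show ?thesis using inB0 v(2) by (metis in_set_conv_nth)
  qed
  have m_off: "m v = v" if "v \<in> ?W - ?Z" for v using that by (simp add: m_def)
  have mZ: "m v \<in> ?Z" if v: "v \<in> ?Z \<inter> ?W" for v
  proof -
    obtain p i where "p \<in> P" "Suc i < length p" "v = p ! i" using Zcase v by blast
    then show ?thesis using m_nth by (metis UN_I nth_mem)
  qed
  have inj: "inj_on m ?W"
  proof (rule inj_onI)
    fix v w assume vw: "v \<in> ?W" "w \<in> ?W" "m v = m w"
    show "v = w"
    proof (cases "v \<in> ?Z \<and> w \<in> ?Z")
      case True
      then obtain p i q j where pq: "p \<in> P" "Suc i < length p" "v = p ! i"
        "q \<in> P" "Suc j < length q" "w = q ! j" using Zcase vw by (metis DiffE)
      then have eq: "p ! Suc i = q ! Suc j" using m_nth vw(3) by metis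
      then have "p = q" using disj pq by (metis nth_mem)
      then show ?thesis using eq pq path(1) by (metis Suc_inject nth_eq_iff_index_eq)
    next
      \<comment> \<open>\<open>m\<close> is the identity off \<open>?Z\<close> and sends non-exits
        on \<open>?Z\<close> into \<open>?Z\<close>, so equal images force both vertices off
        \<open>?Z\<close>.\<close>
      case False
      then show ?thesis using m_off mZ vw by (metis DiffI IntI)
    qed
  qed
  have arc: "(v, m v) \<in> parcs D" if v: "v \<in> ?W" "m v \<noteq> v" for v
  proof -
    have "v \<in> ?Z" using v m_off by blast
    then obtain p i where "p \<in> P" "Suc i < length p" "v = p ! i" using Zcase v(1) by blast
    then show ?thesis using m_nth path(5) by metis
  qed
  have reach: "\<exists>k. (m ^^ k) v \<in> B0" if "v \<in> ?Z" for v
  proof -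
    obtain p i where p: "p \<in> P" "i < length p" "v = p ! i" using \<open>v \<in> ?Z\<close> by (metis UN_E in_set_conv_nth)
    have "(m ^^ k) v = p ! (i + k)" if "i + k < length p" for k
      using that by (induction k) (use p m_nth in auto)
    from this[of "length p - 1 - i"] have "(m ^^ (length p - 1 - i)) v = last p"
      using p path(2) by (simp add: last_conv_nth)
    then show ?thesis using path(4) p(1) by metis
  qed
  have hd: "hd p \<noteq> m v" if p: "p \<in> P" and v: "v \<in> ?W" for p v
  proof
    assume eq: "hd p = m v"
    have hdZ: "hd p \<in> ?Z" using path(2) p by (metis UN_I hd_in_set)
    have "v \<in> ?Z" using m_off v hdZ eq by (metis DiffI)
    then obtain q i where q: "q \<in> P" "Suc i < length q" "v = q ! i" using Zcase v by blast
    then have "p ! 0 = q ! Suc i" using m_nth eq path(2) p by (metis hd_conv_nth)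
    moreover from this have "p = q" using disj q p path(2) by (metis length_greater_0_conv nth_mem)
    ultimately show False using q path(1) nth_eq_iff_index_eq[of q 0 "Suc i"] by force
  qed
  show ?thesis
  proof (rule that)
    show "matching_fun D B0 m" using inj arc by (simp add: matching_fun_def)
    show "follows m ?W B0 ?Z" using m_off mZ reach by (simp add: follows_def)
    show "hd ` P \<inter> m ` ?W = {}" using hd by auto
  qed
qed

section \<open>Combs\<close>

lemma vpath_join:
  assumes "vpath p G" "vpath q G" "last p = hd q" "set p \<inter> set (tl q) = {}"
  shows "vpath (p @ tl q) G"
proof -
  have "vwalk (p @ tl q) G"
    using vwalk_joinI_vwalk'[of p G q] assms by (auto simp: vpath_def vwalk_join_def)
  moreover have "distinct (p @ tl q)" using assms by (auto simp: vpath_def distinct_tl)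
  ultimately show ?thesis by (simp add: vpath_def)
qed

lemma vpath_append_left: "vpath (p @ q) G \<Longrightarrow> p \<noteq> [] \<Longrightarrow> vpath p G"
  by (auto simp: vpath_def intro: vwalkI_append_l)

lemma set_tl_subset_inner: "set (tl p) \<subseteq> insert (last p) (inner_verts p)"
proof (cases p)
  case (Cons a q)
  then show ?thesis by (cases q rule: rev_cases) (auto simp: inner_verts_def butlast_append)
qed simp

lemma set_subset_inner: "p \<noteq> [] \<Longrightarrow> set p \<subseteq> insert (hd p) (insert (last p) (inner_verts p))"
  using set_tl_subset_inner[of p] by (cases p) auto

lemma inner_verts_subset_tl: "inner_verts p \<subseteq> set (tl p)"
  by (auto simp: inner_verts_def butlast_tl[symmetric] dest: in_set_butlastD)

lemma vwalk_arcs_map: "vwalk_arcs (map h p) = map (map_prod h h) (vwalk_arcs p)"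
  by (induction p rule: vwalk_arcs.induct) auto

lemma inner_verts_map: "inner_verts (map h p) = h ` inner_verts p"
  by (simp add: inner_verts_def map_tl[symmetric] map_butlast[symmetric])

text \<open>The ray is the union of the nested paths. Each extension is nonempty, so
  \<open>L n\<close> has more than \<open>n\<close> entries, and the diagonal value
  \<open>L k ! k\<close> agrees with every path that is long enough.\<close>

lemma ray_of_vpath_chain:
  assumes path: "\<And>n. vpath (L n) (with_proj G)" and grow: "\<And>n. \<exists>y. y \<noteq> [] \<and> L (Suc n) = L n @ y"
  obtains r where "ray G r" "\<And>n. set (L n) \<subseteq> range r"
proof -
  have prefix: "\<exists>y. L n' = L n @ y" if "n \<le> n'" for n n'
    using that
  proof (induction n' rule: dec_induct)
    case (step k)
    then show ?case using grow[of k] by (metis append_assoc)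
  qed simp
  have len: "n < length (L n)" for n
  proof (induction n)
    case 0
    then show ?case using path[of 0] by (auto simp: vpath_iff_nth)
  next
    case (Suc n)
    then show ?case using grow[of n] by (metis Suc_lessI length_append length_greater_0_conv less_add_same_cancel1 not_less_eq order_less_trans)
  qed
  define r where "r k = L k ! k" for k
  have r: "r k = L n ! k" if k: "k < length (L n)" for k n
  proof (cases "k \<le> n")
    case True
    then obtain y where "L n = L k @ y" using prefix by blast
    then show ?thesis using len[of k] by (simp add: r_def nth_append)
  next
    case False
    then obtain y where "L k = L n @ y" using prefix[of n k] by auto
    then show ?thesis using k by (simp add: r_def nth_append)
  qed
  have "inj r"
  proof (rule injI)
    fix i j assume eq: "r i = r j"
    have ij: "i < length (L (max i j))" "j < length (L (max i j))"
      using len[of "max i j"] by auto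
    then have "L (max i j) ! i = L (max i j) ! j" using eq r by metis
    then show "i = j" using ij path[of "max i j"] by (simp add: vpath_def nth_eq_iff_index_eq)
  qed
  moreover have "(r n, r (Suc n)) \<in> parcs G" for n
    using path[of "Suc n"] len[of "Suc n"] r[of n "Suc n"] by (auto simp: vpath_iff_nth r_def[of "Suc n"])
  moreover have "set (L n) \<subseteq> range r" for n
  proof
    fix v assume "v \<in> set (L n)"
    then obtain k where "k < length (L n)" "v = L n ! k" by (metis in_set_conv_nth)
    then show "v \<in> range r" using r by (metis rangeI)
  qed
  ultimately show ?thesis using that[of r] unfolding ray_def by simp
qed

text \<open>A subdivision of C^O carries a ray, its spine, and infinitely many disjoint paths from
  the spine to exits, its teeth; this is what \<open>comb_free\<close> forbids.\<close>

lemma CO_free_of_comb_free: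
  assumes comb_free: "comb_free D B0"
  shows "CO_free D B0"
  unfolding CO_free_def
proof (rule notI, elim exE conjE)
  fix D' B0'
  assume contains: "contains_dimaze D B0 D' B0'" and "dimaze_subdivision D' B0' CO CO_exits"
  then obtain D'' f P where sub: "subdivides_via f P D'' (add_sink CO CO_exits)" and f_None: "f None = None"
    and D': "D' = \<lparr> pverts = {v. Some v \<in> pverts D''}, parcs = {(u, v). (Some u, Some v) \<in> parcs D''} \<rparr>"
    and B0': "B0' = {v. (Some v, None) \<in> parcs D''}"
    unfolding dimaze_subdivision_def by metis
  let ?G = "add_sink CO CO_exits"
  \<comment> \<open>Shifted indices: \<open>x i\<close> is x_{i+1} and \<open>y i\<close> is
    y_{i+2}, so every natural number is a valid index and tooth \<open>i\<close> leaves the spine at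
    \<open>x (Suc i)\<close>.\<close>
  define x where "x i = Some (CO_x (Suc i))" for i
  define y where "y i = Some (CO_y (Suc (Suc i)))" for i
  have vG: "x i \<in> pverts ?G" "y i \<in> pverts ?G" "None \<in> pverts ?G" for i
    by (auto simp: x_def y_def add_sink_def CO_def)
  have eG: "(x i, x (Suc i)) \<in> parcs ?G" "(x (Suc i), y i) \<in> parcs ?G" "(y i, None) \<in> parcs ?G" for i
    by (auto simp: x_def y_def add_sink_def CO_def CO_exits_def)
  note sub' = sub[unfolded subdivides_via_def]
  have inj: "inj_on f (pverts ?G)" using sub' by (rule conjunct1)
  have sub_arc: "vpath (P e) (with_proj D'') \<and> hd (P e) = f (fst e) \<and> last (P e) = f (snd e) \<and>
      inner_verts (P e) \<inter> f ` pverts ?G = {}" if "e \<in> parcs ?G" for e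
    using sub'[THEN conjunct2, THEN conjunct1] that by (rule bspec)
  have path: "vpath (P e) (with_proj D'')" and ends: "hd (P e) = f (fst e)" "last (P e) = f (snd e)"
    if "e \<in> parcs ?G" for e
    using sub_arc[OF that] by simp_all
  have inner_f: "f u \<notin> inner_verts (P e)" if "e \<in> parcs ?G" "u \<in> pverts ?G" for e u
    using sub_arc[OF that(1)] that(2) by blast
  have "\<forall>e\<in>parcs ?G. \<forall>e'\<in>parcs ?G. e \<noteq> e' \<longrightarrow> inner_verts (P e) \<inter> inner_verts (P e') = {}"
    using sub'[THEN conjunct2, THEN conjunct2, THEN conjunct1] .
  then have inner: "u \<notin> inner_verts (P e')"
    if "e \<in> parcs ?G" "e' \<in> parcs ?G" "e \<noteq> e'" "u \<in> inner_verts (P e)" for e e' u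
    using that by blast
  have f_eq: "f u = f v \<longleftrightarrow> u = v" if "u \<in> pverts ?G" "v \<in> pverts ?G" for u v
    using inj that by (auto dest: inj_onD)
  have ne: "P e \<noteq> []" if "e \<in> parcs ?G" for e using path[OF that] by (auto simp: vpath_iff_nth)
  have to_D: "vpath (map the p) (with_proj D)" if p: "vpath p (with_proj D'')" "None \<notin> set p" for p
  proof -
    have some: "Some (the v) = v" if "v \<in> set p" for v using p(2) that by (cases v) auto
    have "inj_on the (set p)" by (rule inj_onI) (metis some)
    then have "distinct (map the p)" using p(1) by (simp add: distinct_map vpath_def)
    moreover have "set (map the p) \<subseteq> pverts D'"
      using p(1) some by (auto simp: D' vpath_iff_nth)
    moreover have "(map the p ! i, map the p ! Suc i) \<in> parcs D'" if "Suc i < length (map the p)" for i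
      using p(1) that some[of "p ! i"] some[of "p ! Suc i"] by (simp add: D' vpath_iff_nth)
    ultimately have "vpath (map the p) (with_proj D')" using p(1) by (simp add: vpath_iff_nth)
    then show ?thesis
      using contains by (auto simp: contains_dimaze_def subgraph_def vpath_iff_nth)
  qed

  \<comment> \<open>The first \<open>Suc n\<close> segments of the spine, glued at the vertices
    \<open>f (x i)\<close>.\<close>
  define L where "L = rec_nat (P (x 0, x 1)) (\<lambda>n l. l @ tl (P (x (Suc n), x (Suc (Suc n)))))"
  have L0: "L 0 = P (x 0, x 1)" and LSuc: "L (Suc n) = L n @ tl (P (x (Suc n), x (Suc (Suc n))))" for n
    by (simp_all add: L_def)
  have x_eq: "x i = x j \<longleftrightarrow> i = j" "y i = y j \<longleftrightarrow> i = j" "x i \<noteq> y j" "x i \<noteq> None" "y i \<noteq> None" for i j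
    by (auto simp: x_def y_def)
  have L: "vpath (L n) (with_proj D'') \<and> last (L n) = f (x (Suc n)) \<and>
    set (L n) \<subseteq> (\<lambda>i. f (x i)) ` {..Suc n} \<union> (\<Union>i\<le>n. inner_verts (P (x i, x (Suc i))))" for n
  proof (induction n)
    case 0
    show ?case
      using path[OF eG(1)[of 0]] ends[OF eG(1)[of 0]] set_subset_inner[OF ne[OF eG(1)[of 0]]]
      by (auto simp: L0)
  next
    case (Suc n)
    let ?e = "(x (Suc n), x (Suc (Suc n)))"
    have e: "?e \<in> parcs ?G" by (rule eG)
    have tl_sub: "set (tl (P ?e)) \<subseteq> insert (f (x (Suc (Suc n)))) (inner_verts (P ?e))"
      using set_tl_subset_inner[of "P ?e"] ends(2)[OF e] by simp
    have new: "v \<notin> set (L n)" if "v \<in> set (tl (P ?e))" for v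
    proof
      assume "v \<in> set (L n)"
      then consider i where "i \<le> Suc n" "v = f (x i)" | i where "i \<le> n" "v \<in> inner_verts (P (x i, x (Suc i)))"
        using Suc.IH by blast
      then show False
      proof cases
        case 1
        then have "v \<notin> inner_verts (P ?e)" "v \<noteq> f (x (Suc (Suc n)))"
          using inner_f[OF e vG(1)] f_eq vG x_eq by auto
        then show False using that tl_sub by blast
      next
        case 2
        then have "(x i, x (Suc i)) \<noteq> ?e" using x_eq by auto
        then have "v \<notin> inner_verts (P ?e)" "v \<noteq> f (x (Suc (Suc n)))"
          using inner[OF eG(1) e] inner_f[OF eG(1) vG(1)] 2(2) by blast+
        then show False using that tl_sub by blast
      qed
    qed
    have ne_tl: "tl (P ?e) \<noteq> []"
    proof
      assume "tl (P ?e) = []"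
      then have "hd (P ?e) = last (P ?e)" using ne[OF e] by (cases "P ?e") auto
      then show False using ends[OF e] f_eq vG x_eq by auto
    qed
    have "vpath (L (Suc n)) (with_proj D'')"
      unfolding LSuc using vpath_join[of "L n" _ "P ?e"] Suc.IH path[OF e] ends(1)[OF e] new by auto
    moreover have "last (L (Suc n)) = f (x (Suc (Suc n)))"
      using ne_tl ends(2)[OF e] by (simp add: LSuc last_tl)
    moreover have "set (L (Suc n)) \<subseteq> (\<lambda>i. f (x i)) ` {..Suc (Suc n)} \<union> (\<Union>i\<le>Suc n. inner_verts (P (x i, x (Suc i))))"
    proof
      fix v assume "v \<in> set (L (Suc n))"
      then have "v \<in> set (L n) \<or> v = f (x (Suc (Suc n))) \<or> v \<in> inner_verts (P ?e)"
        using tl_sub by (auto simp: LSuc)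
      then show "v \<in> (\<lambda>i. f (x i)) ` {..Suc (Suc n)} \<union> (\<Union>i\<le>Suc n. inner_verts (P (x i, x (Suc i))))"
        using Suc.IH by (fastforce simp: le_Suc_eq)
    qed
    ultimately show ?case by blast
  qed
  have no_None: "None \<notin> inner_verts (P e)" if "e \<in> parcs ?G" for e
    using inner_f[OF that vG(3)] f_None by simp
  have fx: "f (x i) \<noteq> None" "f (y i) \<noteq> None" for i
    using f_eq[OF vG(1) vG(3)] f_eq[OF vG(2) vG(3)] x_eq f_None by metis+
  have LNone: "None \<notin> set (L n)" for n
  proof
    assume "None \<in> set (L n)"
    then consider i where "None = f (x i)" | i where "None \<in> inner_verts (P (x i, x (Suc i)))"
      using L[of n] by blast
    then show False
    proof cases
      case 1
      then show False using fx(1)[of i] by simp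
    next
      case 2
      then show False using no_None[OF eG(1)] by blast
    qed
  qed
  have grow: "\<exists>z. z \<noteq> [] \<and> map the (L (Suc n)) = map the (L n) @ z" for n
  proof -
    have "L (Suc n) \<noteq> L n"
    proof
      assume "L (Suc n) = L n"
      then have "f (x (Suc (Suc n))) = f (x (Suc n))" using L by metis
      then show False using f_eq vG x_eq by auto
    qed
    then show ?thesis by (intro exI[of _ "map the (tl (P (x (Suc n), x (Suc (Suc n)))))"]) (auto simp: LSuc)
  qed
  have "vpath (map the (L n)) (with_proj D)" for n using to_D L LNone by blast
  then obtain r where r: "ray D r" "\<And>n. set (map the (L n)) \<subseteq> range r"
    using ray_of_vpath_chain[of "\<lambda>n. map the (L n)"] grow by metis

  \<comment> \<open>The arc from \<open>y i\<close> to \<open>None\<close> may be subdivided too, so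
    \<open>f (y i)\<close> need not be an exit. Each tooth is followed up to \<open>None\<close>;
    the vertex before it is the exit, and \<open>butlast\<close> makes the tooth end there.\<close>
  define Q where "Q i = P (x (Suc i), y i) @ tl (P (y i, None))" for i
  define p where "p i = map the (butlast (Q i))" for i
  have Q: "vpath (Q i) (with_proj D'')" "last (Q i) = None" "hd (Q i) = f (x (Suc i))"
    "set (Q i) \<subseteq> {f (x (Suc i)), f (y i), None} \<union> inner_verts (P (x (Suc i), y i)) \<union> inner_verts (P (y i, None))" for i
  proof -
    let ?e = "(x (Suc i), y i)" and ?e' = "(y i, None)"
    have s: "set (P ?e) \<subseteq> insert (f (x (Suc i))) (insert (f (y i)) (inner_verts (P ?e)))"
      using set_subset_inner[OF ne[OF eG(2)]] ends[OF eG(2)] by simp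
    have t: "set (tl (P ?e')) \<subseteq> insert None (inner_verts (P ?e'))"
      using set_tl_subset_inner[of "P ?e'"] ends(2)[OF eG(3)] f_None by simp
    have "set (P ?e) \<inter> set (tl (P ?e')) = {}"
    proof -
      have "v \<notin> insert None (inner_verts (P ?e'))" if v: "v \<in> set (P ?e)" for v
      proof -
        have "?e \<noteq> ?e'" using x_eq by auto
        then have "u \<notin> inner_verts (P ?e')" if "u \<in> inner_verts (P ?e)" for u
          using inner[OF eG(2) eG(3)] that by blast
        moreover have "v = f (x (Suc i)) \<or> v = f (y i) \<or> v \<in> inner_verts (P ?e)" using v s by blast
        moreover from this have "v \<noteq> None" using no_None[OF eG(2), of i] fx by metis
        ultimately show ?thesis
          using inner_f[OF eG(3) vG(1)] inner_f[OF eG(3) vG(2)] by auto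
      qed
      then show ?thesis using t by blast
    qed
    then show "vpath (Q i) (with_proj D'')"
      unfolding Q_def using path[OF eG(2)] path[OF eG(3)] ends(2)[OF eG(2)] ends(1)[OF eG(3)] by (intro vpath_join) auto
    have "tl (P ?e') \<noteq> []"
    proof
      assume "tl (P ?e') = []"
      then have "hd (P ?e') = last (P ?e')" using ne[OF eG(3)] by (cases "P ?e'") auto
      then show False using ends[OF eG(3)] fx f_None by auto
    qed
    then show "last (Q i) = None"
      using ends(2)[OF eG(3)] f_None by (simp add: Q_def last_tl)
    show "hd (Q i) = f (x (Suc i))" using ends(1)[OF eG(2)] ne[OF eG(2)] by (simp add: Q_def)
    show "set (Q i) \<subseteq> {f (x (Suc i)), f (y i), None} \<union> inner_verts (P ?e) \<union> inner_verts (P ?e')"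
      using s t by (auto simp: Q_def)
  qed
  have Q_split: "Q i = butlast (Q i) @ [None]" "butlast (Q i) \<noteq> []" for i
  proof -
    have "Q i \<noteq> []" using Q(1) by (auto simp: vpath_iff_nth)
    then show *: "Q i = butlast (Q i) @ [None]" using Q(2) by (metis append_butlast_last_id)
    show "butlast (Q i) \<noteq> []"
      using * Q(3)[of i] fx by (metis append_Nil list.sel(1))
  qed
  have Q_None: "None \<notin> set (butlast (Q i))" for i
    using Q(1)[of i] Q_split(1)[of i] by (metis distinct_append disjoint_iff list.set_intros(1) vpath_def)
  have p_path: "vpath (p i) (with_proj D)" for i
    unfolding p_def using to_D Q_None vpath_append_left Q_split Q(1) by metis
  have p_last: "last (p i) \<in> B0" for i
  proof -
    have "(last (butlast (Q i)), None) \<in> parcs D''"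
    proof -
      have "set (vwalk_arcs (Q i)) \<subseteq> parcs D''" using Q(1)[of i] by (simp add: vpath_def vwalk_def)
      then show ?thesis using Q_split[of i] set_vwalk_arcs_snoc[of "butlast (Q i)" None] by auto
    qed
    moreover have "Some (last (p i)) = last (butlast (Q i))"
      using Q_None[of i] Q_split(2)[of i] unfolding p_def
      by (metis last_in_set last_map option.collapse)
    ultimately have "last (p i) \<in> B0'" by (simp add: B0')
    then show ?thesis using contains by (auto simp: contains_dimaze_def)
  qed
  have p_hd: "Some (hd (p i)) = f (x (Suc i))" for i
    using Q(3)[of i] Q_split fx unfolding p_def by (metis hd_append2 hd_map option.collapse)
  have disj: "set (p i) \<inter> set (p j) = {}" if "i \<noteq> j" for i j
  proof -
    have sub: "Some v \<in> {f (x (Suc i)), f (y i)} \<union> inner_verts (P (x (Suc i), y i)) \<union> inner_verts (P (y i, None))"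
      if v: "v \<in> set (p i)" for v i
    proof -
      obtain u where u: "u \<in> set (butlast (Q i))" "v = the u" using v by (auto simp: p_def)
      then have "u \<noteq> None" using Q_None by metis
      then have "u = Some v" using u(2) by simp
      then show ?thesis using u Q(4)[of i] in_set_butlastD by fastforce
    qed
    have ne_arcs: "(x (Suc i), y i) \<noteq> (x (Suc j), y j)" "(x (Suc i), y i) \<noteq> (y j, None)"
      "(y i, None) \<noteq> (x (Suc j), y j)" "(y i, None) \<noteq> (y j, None)"
      using that by (auto simp: x_def y_def)
    have ne_f: "f (x (Suc i)) \<noteq> f (x (Suc j))" "f (x (Suc i)) \<noteq> f (y j)" "f (y i) \<noteq> f (x (Suc j))" "f (y i) \<noteq> f (y j)"
      using f_eq vG x_eq that by (metis Suc_inject)+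
    show ?thesis
    proof (rule ccontr)
      assume "set (p i) \<inter> set (p j) \<noteq> {}"
      then obtain v where v: "v \<in> set (p i)" "v \<in> set (p j)" by blast
      have named: "w \<notin> inner_verts (P e)" if "w = f (x (Suc l)) \<or> w = f (y l)" "e \<in> parcs ?G" for w l e
        using that(1) inner_f[OF that(2) vG(1)] inner_f[OF that(2) vG(2)] by auto
      have split: "(Some v = f (x (Suc l)) \<or> Some v = f (y l)) \<or>
          (\<exists>e. (e = (x (Suc l), y l) \<or> e = (y l, None)) \<and> Some v \<in> inner_verts (P e))"
        if "v \<in> set (p l)" for l using sub[OF that] by blast
      have arc: "e \<in> parcs ?G" if "e = (x (Suc l), y l) \<or> e = (y l, None)" for e l
        using that eG(2,3) by auto
      from split[OF v(1)] show False
      proof (elim disjE[of "_ \<or> _"] exE conjE)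
        assume 1: "Some v = f (x (Suc i)) \<or> Some v = f (y i)"
        then have "Some v = f (x (Suc j)) \<or> Some v = f (y j)"
          using split[OF v(2)] named[OF 1 arc] by blast
        then show False using 1 ne_f by metis
      next
        fix e assume e: "e = (x (Suc i), y i) \<or> e = (y i, None)" "Some v \<in> inner_verts (P e)"
        have "\<not> (Some v = f (x (Suc j)) \<or> Some v = f (y j))" using named[OF _ arc[OF e(1)]] e(2) by blast
        then obtain e' where e': "e' = (x (Suc j), y j) \<or> e' = (y j, None)" "Some v \<in> inner_verts (P e')"
          using split[OF v(2)] by blast
        have "e \<noteq> e'" using e(1) e'(1) ne_arcs by metis
        then show False using inner[OF arc[OF e(1)] arc[OF e'(1)]] e(2) e'(2) by blast
      qed
    qed
  qed
  have "linkage D B0 (range p)"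
    unfolding linkage_def
  proof (intro conjI ballI impI)
    fix l assume l: "l \<in> range p"
    then show "vpath l (with_proj D)" "last l \<in> B0" using p_path p_last by auto
    fix l' assume l': "l' \<in> range p" "l \<noteq> l'"
    obtain i j where "l = p i" "l' = p j" using l l'(1) by blast
    then show "set l \<inter> set l' = {}" using disj[of i j] l'(2) by auto
  qed
  then have "linkable D B0 (hd ` range p)" by (auto simp: linkable_def)
  moreover have "hd ` range p \<subseteq> range r"
  proof
    fix v assume "v \<in> hd ` range p"
    then obtain i where i: "v = hd (p i)" by blast
    have "L i \<noteq> []" using L[of i] by (auto simp: vpath_iff_nth)
    then have "f (x (Suc i)) \<in> set (L i)" using L[of i] by (metis last_in_set)
    then have "the (f (x (Suc i))) \<in> set (map the (L i))" by simp
    moreover have "v = the (f (x (Suc i)))" using p_hd[of i] i by (metis option.sel)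
    ultimately show "v \<in> range r" using r(2)[of i] by blast
  qed
  ultimately have "finite (hd ` range p)" using comb_free r(1) by (simp add: comb_free_def)
  moreover have "inj (\<lambda>i. hd (p i))"
    using p_hd f_eq[OF vG(1) vG(1)] x_eq(1) by (intro injI) (metis Suc_inject)
  ultimately show False using finite_imageD[of "\<lambda>i. hd (p i)" UNIV] by (simp add: image_image)
qed

text \<open>An infinite linkage from a ray is pruned to a comb. Cutting each path at its last vertex
  on the ray makes it meet the ray only in its head, and the new heads are still distinct. Numbering
  them in the order of the ray turns the ray into a subdivided spine.\<close>

lemma comb_free_of_CO_free:
  assumes dimaze: "dimaze D B0" and free: "CO_free D B0"
  shows "comb_free D B0"
  unfolding comb_free_def
proof (intro allI impI, rule ccontr)
  fix r A assume ray: "ray D r" and A: "A \<subseteq> range r" "linkable D B0 A" "infinite A"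
  obtain P where P: "linkage D B0 P" "hd ` P = A" using A(2) by (auto simp: linkable_def)
  have path: "p \<noteq> []" if "p \<in> P" for p using P(1) that by (auto simp: linkage_def vpath_iff_nth)
  have "\<exists>zs z. (\<exists>ys. p = ys @ z # zs) \<and> z \<in> range r \<and> set zs \<inter> range r = {}" if p: "p \<in> P" for p
  proof -
    have "\<exists>v\<in>set p. v \<in> range r" using path[OF p] P(2) A(1) p by (meson hd_in_set imageI subsetD)
    then obtain ys z zs where "p = ys @ z # zs" "z \<in> range r" "\<forall>v\<in>set zs. v \<notin> range r"
      using split_list_last_prop[of p "\<lambda>v. v \<in> range r"] by blast
    then show ?thesis by blast
  qed
  then obtain zs z where g: "\<And>p. p \<in> P \<Longrightarrow> (\<exists>ys. p = ys @ z p # zs p) \<and> z p \<in> range r \<and> set (zs p) \<inter> range r = {}"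
    by metis
  define P' where "P' = (\<lambda>p. z p # zs p) ` P"
  have P': "linkage D B0 P'"
    unfolding P'_def by (rule linkage_suffixes[OF P(1) order_refl]) (use g in auto)
  have hd_P': "hd q \<in> range r" "set (tl q) \<inter> range r = {}" if q: "q \<in> P'" for q
  proof -
    obtain p where "p \<in> P" "q = z p # zs p" using q by (auto simp: P'_def)
    then show "hd q \<in> range r" "set (tl q) \<inter> range r = {}" using g by simp_all
  qed
  have inj_z: "inj_on z P"
  proof (rule inj_onI)
    fix p q assume pq: "p \<in> P" "q \<in> P" "z p = z q"
    have "z p \<in> set p" "z q \<in> set q" using g[OF pq(1)] g[OF pq(2)] by (metis in_set_conv_decomp)+
    then show "p = q" using P(1) pq by (auto simp: linkage_def)
  qed
  have "infinite P" using A(3) P(2) by blast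
  then have "infinite (z ` P)" using inj_z by (simp add: finite_image_iff)
  moreover have "z ` P = hd ` P'" by (simp add: P'_def image_image)
  ultimately have inf: "infinite (hd ` P')" by simp
  \<comment> \<open>The positions of the heads on the ray. Increasing enumeration makes the segments
    between consecutive teeth run forwards along the ray and have disjoint interiors.\<close>
  define K where "K = r -` (hd ` P')"
  have "hd ` P' \<subseteq> range r" using hd_P'(1) by blast
  then have "r ` K = hd ` P'" unfolding K_def image_vimage_eq by (rule Int_absorb2)
  then have "infinite K" using inf by (metis finite_imageI)
  define k where "k = enumerate K"
  have k_mono: "k i < k j \<longleftrightarrow> i < j" for i j
    unfolding k_def by (rule enumerate_mono_iff[OF \<open>infinite K\<close>])
  have k_eq: "k i = k j \<longleftrightarrow> i = j" for i j
    using k_mono by (metis less_irrefl linorder_neqE_nat)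
  have "\<exists>q\<in>P'. hd q = r (k i)" for i
  proof -
    have "r (k i) \<in> hd ` P'" using enumerate_in_set[OF \<open>infinite K\<close>, of i] by (simp add: K_def k_def)
    then show ?thesis by (metis imageE)
  qed
  then obtain q where q: "\<And>i. q i \<in> P'" "\<And>i. hd (q i) = r (k i)" by metis
  have r_eq: "r i = r j \<longleftrightarrow> i = j" for i j using ray by (auto simp: ray_def dest: injD)
  have q_path: "vpath (q i) (with_proj D)" "last (q i) \<in> B0" for i
    using P' q(1) by (auto simp: linkage_def)
  have q_ne: "q i \<noteq> []" for i using q_path(1) by (auto simp: vpath_iff_nth)
  have q_disj: "i = j" if "v \<in> set (q i)" "v \<in> set (q j)" for i j v
  proof -
    have "q i = q j" using P' q(1) that unfolding linkage_def by blast
    then have "r (k i) = r (k j)" using q(2) by metis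
    then show ?thesis using r_eq k_eq by simp
  qed
  have q_off: "v \<notin> range r" if "v \<in> set (tl (q i))" for v i
    using hd_P'(2)[OF q(1)[of i]] that by blast
  \<comment> \<open>A vertex of a ray has an outgoing arc and so is no exit. Hence every tooth has
    at least one arc and ends off the spine.\<close>
  have exit_off: "r j \<notin> B0" for j using ray dimaze by (auto simp: ray_def dimaze_def)
  have q_tl: "tl (q i) \<noteq> []" for i
  proof
    assume "tl (q i) = []"
    then have "last (q i) = hd (q i)" using q_ne[of i] by (cases "q i") auto
    then show False using q_path(2)[of i] q(2)[of i] exit_off by metis
  qed
  have last_tl_q: "last (q i) \<in> set (tl (q i))" for i using q_tl[of i] by (metis last_in_set last_tl)
  have last_off: "last (q i) \<noteq> r j" for i j using q_off[OF last_tl_q] by blast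
  have last_eq: "last (q i) = last (q j) \<longleftrightarrow> i = j" for i j
    using q_disj q_ne by (metis last_in_set)
  have last_inner: "last (q j) \<notin> inner_verts (q i)" for i j
  proof
    assume *: "last (q j) \<in> inner_verts (q i)"
    then have "last (q j) \<in> set (q i)" using inner_verts_subset_tl by (metis list.set_sel(2) q_ne subsetD)
    then have "j = i" using q_disj q_ne by (metis last_in_set)
    then have "last (q i) \<in> set (butlast (q i))" using * q_tl[of i]
      by (metis butlast.simps(1) inner_verts_def list.sel(2) list.set_sel(2))
    then show False using q_path(1)[of i] q_ne[of i]
      by (metis append_butlast_last_id distinct_append disjoint_iff list.set_intros(1) vpath_def)
  qed

  let ?G = "add_sink CO CO_exits"
  \<comment> \<open>\<open>CO_y i\<close> is placed at the exit of tooth \<open>i\<close>, so the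
    arcs to \<open>None\<close> stay undivided and only spine and teeth contribute inner
    vertices.\<close>
  define f where "f = (\<lambda>None \<Rightarrow> None | Some (CO_x i) \<Rightarrow> Some (r (k i)) | Some (CO_y i) \<Rightarrow> Some (last (q i)))"
  \<comment> \<open>The bound \<open>Suc (k j)\<close> makes a spine segment contain both of its
    ends.\<close>
  define PP where "PP = (\<lambda>(Some (CO_x i), Some (CO_x j)) \<Rightarrow> map (\<lambda>t. Some (r t)) [k i..<Suc (k j)]
    | (Some (CO_x i), _) \<Rightarrow> map Some (q i)
    | (Some (CO_y i), _) \<Rightarrow> [Some (last (q i)), None]
    | (None, _) \<Rightarrow> [])"
  have f [simp]: "f None = None" "f (Some (CO_x i)) = Some (r (k i))" "f (Some (CO_y i)) = Some (last (q i))" for i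
    by (simp_all add: f_def)
  have PP [simp]: "PP (Some (CO_x i), Some (CO_x j)) = map (\<lambda>t. Some (r t)) [k i..<Suc (k j)]"
    "PP (Some (CO_x i), Some (CO_y j)) = map Some (q i)"
    "PP (Some (CO_y i), None) = [Some (last (q i)), None]" for i j
    by (simp_all add: PP_def del: upt_Suc)
  define D'' where "D'' = \<lparr>pverts = f ` pverts ?G \<union> (\<Union>e\<in>parcs ?G. inner_verts (PP e)),
    parcs = (\<Union>e\<in>parcs ?G. set (vwalk_arcs (PP e)))\<rparr>"
  have f_cases: "(\<exists>i. w = Some (r (k i))) \<or> (\<exists>i. w = Some (last (q i))) \<or> w = None" if "w \<in> f ` UNIV" for w
    using that by (auto simp: f_def split: option.splits CO_vertex.splits)
  have arc_cases: "(\<exists>i. e = (Some (CO_x i), Some (CO_x (Suc i)))) \<or> (\<exists>i. e = (Some (CO_x i), Some (CO_y i)))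
      \<or> (\<exists>i. e = (Some (CO_y i), None))" if "e \<in> parcs ?G" for e
    using that by (auto simp: add_sink_def CO_def CO_exits_def)
  have inner_x: "inner_verts (PP (Some (CO_x i), Some (CO_x (Suc i)))) = (\<lambda>t. Some (r t)) ` {k i<..<k (Suc i)}" for i
  proof -
    have "k i < k (Suc i)" using k_mono by simp
    then have "tl (butlast [k i..<Suc (k (Suc i))]) = [Suc (k i)..<k (Suc i)]"
      by (simp add: upt_conv_Cons)
    then have "inner_verts [k i..<Suc (k (Suc i))] = {k i<..<k (Suc i)}"
      unfolding inner_verts_def by (simp only: set_upt atLeastSucLessThan_greaterThanLessThan)
    then show ?thesis by (simp only: PP inner_verts_map)
  qed
  have inner_y: "inner_verts (PP (Some (CO_x i), Some (CO_y i))) = Some ` inner_verts (q i)" for i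
    by (simp add: inner_verts_map)
  have inner_n: "inner_verts (PP (Some (CO_y i), None)) = {}" for i by (simp add: inner_verts_def)
  have PP_props: "PP e \<noteq> [] \<and> distinct (PP e) \<and> hd (PP e) = f (fst e) \<and> last (PP e) = f (snd e)"
    if e: "e \<in> parcs ?G" for e
  proof -
    consider i where "e = (Some (CO_x i), Some (CO_x (Suc i)))" | i where "e = (Some (CO_x i), Some (CO_y i))"
      | i where "e = (Some (CO_y i), None)" using arc_cases[OF e] by blast
    then show ?thesis
    proof cases
      case (1 i)
      have "k i < k (Suc i)" using k_mono by simp
      then have upt: "[k i..<Suc (k (Suc i))] \<noteq> []" "hd [k i..<Suc (k (Suc i))] = k i"
        "last [k i..<Suc (k (Suc i))] = k (Suc i)" by (simp_all add: hd_append)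
      have "distinct (map (\<lambda>t. Some (r t)) [k i..<Suc (k (Suc i))])"
        by (simp add: distinct_map inj_on_def r_eq del: upt_Suc)
      then show ?thesis unfolding 1 PP using upt by (simp add: hd_map last_map del: upt_Suc)
    next
      case (2 i)
      then show ?thesis using q_path(1)[of i] q_ne[of i] q(2)[of i]
        by (simp add: distinct_map vpath_def hd_map last_map)
    next
      case (3 i)
      then show ?thesis by simp
    qed
  qed
  have PP_vpath: "vpath (PP e) (with_proj D'')" if e: "e \<in> parcs ?G" for e
  proof -
    have "fst e \<in> pverts ?G" "snd e \<in> pverts ?G" using e by (auto simp: add_sink_def CO_def CO_exits_def)
    then have "set (PP e) \<subseteq> pverts D''"
      using set_subset_inner[of "PP e"] PP_props[OF e] e unfolding D''_def by auto
    moreover have "set (vwalk_arcs (PP e)) \<subseteq> parcs D''" using e by (auto simp: D''_def)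
    ultimately show ?thesis using PP_props[OF e] by (simp add: vpath_def vwalk_def)
  qed
  have "subdivides_via f PP D'' ?G"
    unfolding subdivides_via_def
  proof (intro conjI ballI impI)
    show "inj_on f (pverts ?G)"
      by (rule inj_onI) (auto simp: f_def r_eq k_eq last_eq last_off last_off[symmetric] split: option.splits CO_vertex.splits)
    fix e assume e: "e \<in> parcs ?G"
    show "vpath (PP e) (with_proj D'')" by (rule PP_vpath[OF e])
    show "hd (PP e) = f (fst e)" "last (PP e) = f (snd e)" using PP_props[OF e] by simp_all
    show "inner_verts (PP e) \<inter> f ` pverts ?G = {}"
    proof -
      have "w \<notin> inner_verts (PP e)" if w: "w \<in> f ` UNIV" for w
        using arc_cases[OF e]
      proof (elim disjE exE)
        fix i assume i: "e = (Some (CO_x i), Some (CO_x (Suc i)))"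
        have "\<not> (k i < k j \<and> k j < k (Suc i))" for j using k_mono by auto
        then show ?thesis using f_cases[OF w] unfolding i inner_x
          by (auto simp: r_eq last_off last_off[symmetric])
      next
        fix i assume i: "e = (Some (CO_x i), Some (CO_y i))"
        have "r j \<notin> inner_verts (q i)" for j using q_off inner_verts_subset_tl by (metis rangeI subsetD)
        then show ?thesis using f_cases[OF w] last_inner unfolding i inner_y by auto
      next
        fix i assume i: "e = (Some (CO_y i), None)"
        show ?thesis unfolding i inner_n by simp
      qed
      then show ?thesis by blast
    qed
    fix e' assume e': "e' \<in> parcs ?G" "e \<noteq> e'"
    have xx: "i = j" if "t \<in> {k i<..<k (Suc i)}" "t \<in> {k j<..<k (Suc j)}" for t i j
    proof -
      have "k i < k (Suc j)" "k j < k (Suc i)" using that by auto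
      then show ?thesis using k_mono by simp
    qed
    have xy: "r t \<notin> inner_verts (q j)" for t j using q_off inner_verts_subset_tl by (metis rangeI subsetD)
    have yy: "i = j" if "v \<in> inner_verts (q i)" "v \<in> inner_verts (q j)" for v i j
      using that q_disj inner_verts_subset_tl by (metis list.set_sel(2) q_ne subsetD)
    show "inner_verts (PP e) \<inter> inner_verts (PP e') = {}"
      using arc_cases[OF e] arc_cases[OF e'(1)] e'(2)
      apply (elim disjE exE)
              apply (simp_all only: inner_x inner_y inner_n)
              apply (auto simp: r_eq xy dest: xx yy)
      done
  qed (simp_all add: D''_def)
  moreover define D' where "D' = \<lparr> pverts = {v. Some v \<in> pverts D''}, parcs = {(u, v). (Some u, Some v) \<in> parcs D''} \<rparr>"
  moreover define B0' where "B0' = {v. (Some v, None) \<in> parcs D''}"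
  ultimately have "dimaze_subdivision D' B0' CO CO_exits"
    unfolding dimaze_subdivision_def using f(1) by blast
  moreover have "contains_dimaze D B0 D' B0'"
  proof -
    have arcs: "(\<exists>u v. e' = (Some u, Some v) \<and> (u, v) \<in> parcs D) \<or> (\<exists>u\<in>B0. e' = (Some u, None))"
      if e': "e' \<in> parcs D''" for e'
    proof -
      obtain e where e: "e \<in> parcs ?G" "e' \<in> set (vwalk_arcs (PP e))" using e' by (auto simp: D''_def)
      show ?thesis using arc_cases[OF e(1)]
      proof (elim disjE exE)
        fix i assume i: "e = (Some (CO_x i), Some (CO_x (Suc i)))"
        obtain j where j: "Suc j < length (PP e)" "e' = (PP e ! j, PP e ! Suc j)"
          using e(2) by (auto simp: set_vwalk_arcs_nth)
        then have "e' = (Some (r (k i + j)), Some (r (Suc (k i + j))))"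
          by (simp add: i del: upt_Suc)
        then show ?thesis using ray by (simp add: ray_def)
      next
        fix i assume i: "e = (Some (CO_x i), Some (CO_y i))"
        have "set (vwalk_arcs (q i)) \<subseteq> parcs D" using q_path(1)[of i] by (simp add: vpath_def vwalk_def)
        then show ?thesis using e(2) by (auto simp: i vwalk_arcs_map)
      next
        fix i assume i: "e = (Some (CO_y i), None)"
        then show ?thesis using e(2) q_path(2)[of i] by simp
      qed
    qed
    have D_wf: "pair_wf_digraph D" using dimaze by (simp add: dimaze_def pair_loopfree_digraph_def)
    have arc_D': "(u, v) \<in> parcs D" if "(u, v) \<in> parcs D'" for u v
      using arcs[of "(Some u, Some v)"] that by (simp add: D'_def)
    have arc_ends: "e' \<in> pverts D'' \<times> pverts D''" if e': "e' \<in> parcs D''" for e'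
    proof -
      obtain e where e: "e \<in> parcs ?G" "e' \<in> set (vwalk_arcs (PP e))" using e' by (auto simp: D''_def)
      have "set (PP e) \<subseteq> pverts D''" using PP_vpath[OF e(1)] by (simp add: vpath_def vwalk_def)
      then show ?thesis using arcs_in_vwalk_arcs[OF e(2)] by blast
    qed
    have D'_wf: "pair_wf_digraph D'"
      unfolding pair_wf_digraph_def D'_def using arc_ends by auto
    have verts: "v \<in> pverts D" if "v \<in> pverts D'" for v
    proof -
      have r_in: "r t \<in> pverts D" for t using ray D_wf pair_wf_digraph.in_arcsD1 unfolding ray_def by metis
      have q_in: "set (q i) \<subseteq> pverts D" for i using q_path(1) by (simp add: vpath_iff_nth)
      have "Some v \<in> f ` pverts ?G \<union> (\<Union>e\<in>parcs ?G. inner_verts (PP e))"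
        using that by (simp add: D'_def D''_def)
      then show ?thesis
      proof
        assume "Some v \<in> f ` pverts ?G"
        then show ?thesis using f_cases[of "Some v"] r_in q_in last_in_set[OF q_ne] by blast
      next
        assume "Some v \<in> (\<Union>e\<in>parcs ?G. inner_verts (PP e))"
        then obtain e where e: "e \<in> parcs ?G" "Some v \<in> inner_verts (PP e)" by blast
        show ?thesis using arc_cases[OF e(1)]
        proof (elim disjE exE)
          fix i assume i: "e = (Some (CO_x i), Some (CO_x (Suc i)))"
          show ?thesis using e(2) r_in unfolding i inner_x by auto
        next
          fix i assume i: "e = (Some (CO_x i), Some (CO_y i))"
          show ?thesis using e(2) q_in inner_verts_subset_tl list.set_sel(2)[OF q_ne]
            unfolding i inner_y by (metis imageE option.inject subsetD)
        next
          fix i assume i: "e = (Some (CO_y i), None)"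
          show ?thesis using e(2) unfolding i inner_n by simp
        qed
      qed
    qed
    have "wf_digraph (with_proj D)" "wf_digraph (with_proj D')"
      using D_wf D'_wf by (auto simp: wf_digraph_def pair_wf_digraph_def)
    moreover have "parcs D' \<subseteq> parcs D" using arc_D' by auto
    ultimately have "subgraph (with_proj D') (with_proj D)"
      using verts by (auto simp: subgraph_def compatible_def)
    moreover have "B0' \<subseteq> B0" using arcs by (auto simp: B0'_def)
    ultimately show ?thesis by (simp add: contains_dimaze_def)
  qed
  ultimately show False using free unfolding CO_free_def by blast
qed

section \<open>Shifting along a linkage\<close>

text \<open>The last three assumptions are what \<open>matching_fun_of_linkage\<close> provides, so
  \<open>m\<close> stands in for the successor map of \<open>P\<close>.\<close>

locale shifted_dimaze =
  fixes D :: "'v pair_pre_digraph" and B0 :: "'v set" and P :: "'v list set" and m :: "'v \<Rightarrow> 'v"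
  assumes dimaze: "dimaze D B0" and comb_free: "comb_free D B0" and linkage: "linkage D B0 P"
    and matching: "matching_fun D B0 m"
    and follows: "follows m (pverts D - B0) B0 (\<Union>p\<in>P. set p)"
    and heads_unmatched: "hd ` P \<inter> m ` (pverts D - B0) = {}"
begin

abbreviation W :: "'v set" where "W \<equiv> pverts D - B0"

abbreviation Z :: "'v set" where "Z \<equiv> \<Union>p\<in>P. set p"

text \<open>The shift of \<open>D\<close> along \<open>m\<close>: every non-exit \<open>v\<close> is renamed to \<open>m v\<close>, while the possible
  targets of \<open>v\<close>, including \<open>v\<close> itself, keep their names. Hence a matching function \<open>n\<close> of the
  shifted dimaze corresponds to the matching function \<open>n \<circ> m\<close> of \<open>D\<close>.\<close>

definition D1 :: "'v pair_pre_digraph" where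
  "D1 = \<lparr> pverts = pverts D,
          parcs = {(m v, u) | v u. v \<in> W \<and> (u = v \<or> (v, u) \<in> parcs D) \<and> u \<noteq> m v} \<rparr>"

text \<open>These are the vertices that are not a name \<open>m v\<close>. They include the heads of
  \<open>P\<close> and the old exits off the linkage, while non-exits off the linkage are their own
  names.\<close>

definition B1 :: "'v set" where
  "B1 = pverts D - m ` W"

lemma wf: "(u, v) \<in> parcs D \<Longrightarrow> u \<in> pverts D \<and> v \<in> pverts D"
  using dimaze pair_wf_digraph.in_arcsD1 pair_wf_digraph.in_arcsD2
  by (metis dimaze_def pair_loopfree_digraph_def)

lemma m_in_verts: "m ` W \<subseteq> pverts D"
  using matching_fun_in_verts[OF dimaze matching] by auto

lemma inj_m: "inj_on m W"
  using matching by (simp add: matching_fun_def)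

lemma pverts_D1 [simp]: "pverts D1 = pverts D"
  by (simp add: D1_def)

lemma nonexits_D1: "pverts D1 - B1 = m ` W"
  using m_in_verts by (auto simp: B1_def)

text \<open>Injectivity makes \<open>v\<close> recoverable from its name \<open>m v\<close>. The
  alternative \<open>u = v\<close> is the step backwards along the linkage.\<close>

lemma arcs_D1: "v \<in> W \<Longrightarrow> (m v, u) \<in> parcs D1 \<longleftrightarrow> (u = v \<or> (v, u) \<in> parcs D) \<and> u \<noteq> m v"
  using inj_m by (auto simp: D1_def dest: inj_onD)

lemma arc_D1_tail: "(w, u) \<in> parcs D1 \<Longrightarrow> w \<in> m ` W"
  by (auto simp: D1_def)

lemma dimaze_D1: "dimaze D1 B1"
  unfolding dimaze_def pair_loopfree_digraph_def pair_loopfree_digraph_axioms_def pair_wf_digraph_def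
  using m_in_verts wf by (auto simp: D1_def B1_def)

lemma heads_subset_B1: "hd ` P \<subseteq> B1"
proof -
  have "hd ` P \<subseteq> pverts D" using linkage by (fastforce simp: linkage_def vpath_iff_nth)
  then show ?thesis using heads_unmatched by (auto simp: B1_def)
qed

text \<open>Non-exits in \<open>Z\<close> are mapped into \<open>Z\<close>, so \<open>v\<close> lies
  off \<open>Z\<close> as well and is fixed.\<close>

lemma m_off: "m v \<notin> Z \<Longrightarrow> v \<in> W \<Longrightarrow> m v = v"
  using follows by (fastforce simp: follows_def)

text \<open>An infinite orbit of \<open>n \<circ> m\<close> is a ray of \<open>D\<close>; it meets \<open>Z\<close> only finitely often, and outside
  \<open>Z\<close> it is an orbit of \<open>n\<close>.\<close>

lemma linkable_compose:
  assumes n: "matching_fun D1 B1 n" and A: "A \<subseteq> pverts D" "A \<inter> n ` m ` W = {}"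
    and no_tail: "\<And>q. ray D q \<Longrightarrow> \<forall>k. q k \<notin> Z \<and> q k \<in> m ` W \<and> n (q k) = q (Suc k) \<Longrightarrow> False"
  shows "linkable D B0 A"
proof (rule linkable_of_matching_fun[where m = "n \<circ> m"])
  show nm: "matching_fun D B0 (n \<circ> m)"
    unfolding matching_fun_def
  proof (intro conjI ballI impI)
    show "inj_on (n \<circ> m) W"
      using inj_m n nonexits_D1 by (intro comp_inj_on) (auto simp: matching_fun_def)
    fix v assume v: "v \<in> W" "(n \<circ> m) v \<noteq> v"
    show "(v, (n \<circ> m) v) \<in> parcs D"
    \<comment> \<open>If \<open>n\<close> rests at \<open>m v\<close>, the step is an arc of the
      linkage. Otherwise it is an arc of \<open>D1\<close> with tail \<open>m v\<close>, and since
      its head is not \<open>v\<close> it comes from an arc of \<open>D\<close> with tail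
      \<open>v\<close>.\<close>
    proof (cases "n (m v) = m v")
      case True
      then show ?thesis using v matching by (simp add: matching_fun_def)
    next
      case False
      then have "(m v, n (m v)) \<in> parcs D1"
        using n nonexits_D1 v by (simp add: matching_fun_def)
      then show ?thesis using v arcs_D1 by auto
    qed
  qed
  fix a assume a: "a \<in> A"
  show "\<exists>k. ((n \<circ> m) ^^ k) a \<in> B0"
  proof (rule ccontr)
    assume neg: "\<not> ?thesis"
    define r where "r k = ((n \<circ> m) ^^ k) a" for k
    have a': "a \<in> pverts D" "a \<notin> (n \<circ> m) ` W" using a A by auto
    have r: "ray D r" "\<And>k. r k \<in> W"
      using matching_fun_orbit_ray[OF dimaze nm a'] neg by (auto simp: r_def[abs_def])
    have "finite (range r \<inter> Z)" by (rule comb_free_ray_Int_linkage[OF comb_free linkage r(1)])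
    then obtain N where N: "\<And>k. k \<ge> N \<Longrightarrow> r k \<notin> Z"
      using finite_range_Int_tail[of r] r(1) by (metis ray_def)
    have stay: "m (r k) = r k" if "k \<ge> N" for k
      using N[OF that] r(2) follows by (simp add: follows_def)
    then have "r k \<in> m ` W" if "k \<ge> N" for k using that r(2) by (metis imageI)
    moreover have "n (r k) = r (Suc k)" if "k \<ge> N" for k using stay[OF that] by (simp add: r_def)
    ultimately show False
      using no_tail[OF ray_tail[OF r(1), of N]] N by auto
  qed
qed (use dimaze A in \<open>auto simp: image_comp\<close>)

text \<open>An infinite orbit of \<open>n \<circ> m\<close> would end in a moving orbit of
  \<open>n\<close>. That orbit lies on a path of the shifted linkage and so reaches
  \<open>B1\<close>, although it stays in the image of \<open>W\<close> under \<open>m\<close>,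
  which is disjoint from \<open>B1\<close>.\<close>

lemma linkable_of_shifted:
  assumes "linkable D1 B1 A"
  shows "linkable D B0 A"
proof -
  obtain P1 where P1: "linkage D1 B1 P1" "hd ` P1 = A" using assms by (auto simp: linkable_def)
  then obtain n where n: "matching_fun D1 B1 n"
      "follows n (pverts D1 - B1) B1 (\<Union>p\<in>P1. set p)" "hd ` P1 \<inter> n ` (pverts D1 - B1) = {}"
    using matching_fun_of_linkage[OF dimaze_D1] by metis
  show ?thesis
  proof (rule linkable_compose[OF n(1)])
    show "A \<subseteq> pverts D" using P1 by (fastforce simp: linkage_def vpath_iff_nth)
    show "A \<inter> n ` m ` W = {}" using n(3) P1(2) nonexits_D1 by simp
    fix q assume q: "ray D q" "\<forall>k. q k \<notin> Z \<and> q k \<in> m ` W \<and> n (q k) = q (Suc k)"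
    have iter: "(n ^^ k) (q 0) = q k" for k by (induction k) (use q in auto)
    have "n (q 0) \<noteq> q 0" using q by (metis injD n_not_Suc_n ray_def)
    then have "q 0 \<in> (\<Union>p\<in>P1. set p)"
      using n(2) q(2) nonexits_D1 unfolding follows_def by (metis DiffI)
    then obtain k where "q k \<in> B1" using n(2) iter unfolding follows_def by metis
    then show False using q(2) by (auto simp: B1_def)
  qed
qed

text \<open>Augmentation along an infinite alternating walk: the ray of \<open>D1\<close> alternates between steps
  backwards on the linkage and other arcs of \<open>D\<close>.\<close>

lemma linkable_insert_ray_start:
  assumes r: "ray D1 r" and inf: "infinite (range r \<inter> Z)"
  shows "linkable D B0 (insert (r 0) (hd ` P))"
proof -
  have inj: "inj r" using r by (simp add: ray_def)
  have rW: "r k \<in> m ` W" for k using r arc_D1_tail unfolding ray_def by blast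
  \<comment> \<open>\<open>n\<close> pushes the ray forwards by one step and fixes the rest. So
    \<open>n \<circ> m\<close> is the linkage augmented along the alternating walk, and
    \<open>r 0\<close> is the one value that is vacated.\<close>
  define n where "n w = (if w \<in> range r then r (Suc (inv r w)) else w)" for w
  have n_r: "n (r k) = r (Suc k)" for k using inj by (simp add: n_def)
  have n_off: "n w = w" if "w \<notin> range r" for w using that by (simp add: n_def)
  have "matching_fun D1 B1 n"
    unfolding matching_fun_def
  proof (intro conjI ballI impI)
    show "inj_on n (pverts D1 - B1)"
    proof (rule inj_onI)
      fix u w assume eq: "n u = n w"
      show "u = w"
      proof (cases "u \<in> range r")
        case u: True
        show ?thesis
        proof (cases "w \<in> range r")
          case True
          then show ?thesis using u eq n_r inj by (auto simp: inj_eq)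
        next
          case False
          then show ?thesis using u eq n_r n_off by (metis imageE rangeI)
        qed
      next
        case u: False
        then show ?thesis using eq n_r n_off by (metis imageE rangeI)
      qed
    qed
    fix w assume "n w \<noteq> w"
    then obtain k where "w = r k" using n_off by blast
    then show "(w, n w) \<in> parcs D1" using r n_r by (simp add: ray_def)
  qed
  then show ?thesis
  proof (rule linkable_compose)
    show "insert (r 0) (hd ` P) \<subseteq> pverts D"
      using rW m_in_verts heads_subset_B1 by (auto simp: B1_def)
    show "insert (r 0) (hd ` P) \<inter> n ` m ` W = {}"
    proof -
      have "n w \<notin> insert (r 0) (hd ` P)" if "w \<in> m ` W" for w
      proof (cases "w \<in> range r")
        case True
        then obtain k where "w = r k" by blast
        moreover have "r (Suc k) \<noteq> r 0" using inj by (simp add: inj_eq)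
        moreover have "r (Suc k) \<notin> hd ` P" using rW heads_unmatched by blast
        ultimately show ?thesis using n_r by simp
      next
        case False
        then have "n w = w" "w \<noteq> r 0" using n_off by auto
        moreover have "w \<notin> hd ` P" using that heads_unmatched by blast
        ultimately show ?thesis by simp
      qed
      then have *: "n ` (m ` W) \<subseteq> - insert (r 0) (hd ` P)" by (intro image_subsetI ComplI) (rule notE)
      show ?thesis by (subst Int_commute) (rule *[folded disjoint_eq_subset_Compl])
    qed
    fix q assume q: "ray D q" "\<forall>k. q k \<notin> Z \<and> q k \<in> m ` W \<and> n (q k) = q (Suc k)"
    have "n (q 0) \<noteq> q 0" using q by (metis injD n_not_Suc_n ray_def)
    then obtain i where i: "q 0 = r i" using n_off by blast
    have q_r: "q k = r (i + k)" for k
    proof (induction k)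
      case (Suc k)
      then show ?case using q(2) n_r by (metis add_Suc_right)
    qed (use i in simp)
    \<comment> \<open>\<open>q\<close> is the tail of \<open>r\<close> from index \<open>i\<close>
      on and avoids \<open>Z\<close>, so only the vertices before that index can lie in
      \<open>Z\<close>.\<close>
    have "range r \<inter> Z \<subseteq> r ` {..<i}"
    proof
      fix w assume "w \<in> range r \<inter> Z"
      then obtain k where k: "w = r k" "r k \<in> Z" by auto
      have "k < i" using k(2) q(2) q_r[of "k - i"] by (metis le_add_diff_inverse not_less)
      then show "w \<in> r ` {..<i}" using k(1) by blast
    qed
    then show False using inf by (meson finite_imageI finite_lessThan finite_subset)
  qed
qed

text \<open>Dividing the injection \<open>m'\<close> of a linkage of \<open>I\<close> by
  \<open>m\<close> gives a matching function of \<open>D1\<close>. An orbit that never reaches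
  \<open>B1\<close> does not start at a head of \<open>P\<close>. If it met \<open>Z\<close>
  infinitely often, it would augment \<open>P\<close>, against \<open>max\<close>; otherwise
  \<open>n\<close> agrees with \<open>m'\<close> on a tail, which then follows a finite path of
  \<open>P'\<close> to an exit in \<open>B0\<close>, although it stays in \<open>W\<close>.\<close>

lemma linkable_shifted:
  assumes "linkable D B0 I" and max: "\<And>a. a \<in> I - hd ` P \<Longrightarrow> \<not> linkable D B0 (insert a (hd ` P))"
  shows "linkable D1 B1 I"
proof -
  obtain P' where P': "linkage D B0 P'" "hd ` P' = I" using assms(1) by (auto simp: linkable_def)
  then obtain m' where m': "matching_fun D B0 m'"
      "follows m' W B0 (\<Union>p\<in>P'. set p)" "hd ` P' \<inter> m' ` W = {}"
    using matching_fun_of_linkage[OF dimaze] by metis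
  have I: "I \<subseteq> pverts D" using P' by (fastforce simp: linkage_def vpath_iff_nth)
  define n where "n w = m' (inv_into W m w)" for w
  have n_m: "n (m v) = m' v" if "v \<in> W" for v using that inj_m by (simp add: n_def)
  have nm: "matching_fun D1 B1 n"
    unfolding matching_fun_def nonexits_D1
  proof (intro conjI ballI impI)
    show "inj_on n (m ` W)"
      using m'(1) n_m by (auto simp: inj_on_def matching_fun_def)
    fix w assume w: "w \<in> m ` W" "n w \<noteq> w"
    then obtain v where "v \<in> W" "w = m v" by blast
    \<comment> \<open>If \<open>m'\<close> fixes \<open>v\<close>, the arc is the step backwards
      from \<open>m v\<close> to \<open>v\<close>; otherwise it is the arc from \<open>v\<close> to
      \<open>m' v\<close> with its tail renamed.\<close>
    then show "(w, n w) \<in> parcs D1"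
      using w n_m m'(1) arcs_D1 by (fastforce simp: matching_fun_def)
  qed
  have avoid: "I \<inter> n ` (pverts D1 - B1) = {}" using m'(3) P'(2) n_m nonexits_D1 by auto
  show ?thesis
  proof (rule linkable_of_matching_fun[OF dimaze_D1 nm])
    fix a assume a: "a \<in> I"
    show "\<exists>k. (n ^^ k) a \<in> B1"
    proof (rule ccontr)
      assume neg: "\<not> ?thesis"
      define r where "r k = (n ^^ k) a" for k
      have a': "a \<in> pverts D1" "a \<notin> n ` (pverts D1 - B1)" using a I avoid by auto
      have r: "ray D1 r" "\<And>k. r k \<in> m ` W"
        using matching_fun_orbit_ray[OF dimaze_D1 nm a'] neg nonexits_D1 by (auto simp: r_def[abs_def])
      have "a \<notin> hd ` P" using r(2)[of 0] heads_unmatched by (auto simp: r_def)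
      then have "finite (range r \<inter> Z)"
        using linkable_insert_ray_start[OF r(1)] max[of a] a by (auto simp: r_def)
      then obtain N where N: "\<And>k. k \<ge> N \<Longrightarrow> r k \<notin> Z"
        using finite_range_Int_tail[of r] r(1) by (metis ray_def)
      have stay: "m (r k) = r k \<and> r k \<in> W" if "k \<ge> N" for k
        using N[OF that] r(2)[of k] m_off by (metis imageE)
      have step: "m' (r k) = r (Suc k)" if "k \<ge> N" for k
        using stay[OF that] n_m[of "r k"] by (simp add: r_def)
      have iter: "(m' ^^ k) (r N) = r (N + k)" for k by (induction k) (use step in auto)
      have "r (Suc N) \<noteq> r N" using r(1) by (metis injD n_not_Suc_n ray_def)
      then have "r N \<in> (\<Union>p\<in>P'. set p)"
        using m'(2) step[of N] stay[of N] unfolding follows_def by (metis DiffI order_refl)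
      then obtain k where "r (N + k) \<in> B0" using m'(2) iter unfolding follows_def by metis
      then show False using stay[of "N + k"] by simp
    qed
  qed (use I avoid in auto)
qed

text \<open>A walk is prepended one vertex at a time. If the new vertex is already on the ray, the
  ray is restarted there, which loses finitely many vertices; an infinite intersection with
  \<open>Z\<close> stays infinite.\<close>

lemma ray_from:
  assumes "(x, y) \<in> (parcs G)\<^sup>*" "ray G r" "r 0 = y"
  shows "\<exists>r'. ray G r' \<and> r' 0 = x \<and> finite (range r - range r')"
  using assms(1)
proof (induction rule: converse_rtrancl_induct)
  case base
  then show ?case using assms by auto
next
  case (step x z)
  then obtain r' where r': "ray G r'" "r' 0 = z" "finite (range r - range r')" by blast
  show ?case
  proof (cases "x \<in> range r'")
    case True
    then obtain k where k: "x = r' k" by blast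
    define s where "s n = r' (n + k)" for n
    have "range r' \<subseteq> range s \<union> r' ` {..<k}"
    proof
      fix w assume "w \<in> range r'"
      then obtain n where "w = r' n" by blast
      then show "w \<in> range s \<union> r' ` {..<k}"
        unfolding s_def by (cases "n < k") (auto simp: image_iff intro: exI[of _ "n - k"])
    qed
    then have "range r - range s \<subseteq> (range r - range r') \<union> r' ` {..<k}" by blast
    then have "finite (range r - range s)" using r'(3) by (meson finite_UnI finite_imageI finite_lessThan finite_subset)
    moreover have "ray G s" unfolding s_def by (rule ray_tail[OF r'(1)])
    ultimately show ?thesis using k by (auto simp: s_def intro!: exI[of _ s])
  next
    case False
    define s where "s = case_nat x r'"
    have "inj s" using False r'(1) by (auto simp: s_def ray_def inj_def split: nat.split)
    then have "ray G s" using r' step.hyps(1) by (auto simp: s_def ray_def split: nat.split)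
    moreover have "range r' \<subseteq> range s"
    proof
      fix w assume "w \<in> range r'"
      then obtain n where "w = s (Suc n)" by (auto simp: s_def)
      then show "w \<in> range s" by blast
    qed
    then have "finite (range r - range s)" using r'(3) by (meson Diff_mono finite_subset order_refl)
    ultimately show ?thesis by (auto simp: s_def intro!: exI[of _ s])
  qed
qed

text \<open>In the whole shifted digraph a ray may meet \<open>Z\<close> infinitely often. Reachability from \<open>X\<close>
  makes such a ray start in \<open>X\<close>, where it contradicts the maximality of the set of heads.\<close>

lemma comb_free_shifted:
  assumes max: "\<And>x. x \<in> X - hd ` P \<Longrightarrow> \<not> linkable D B0 (insert x (hd ` P))"
    and sub: "parcs D2 \<subseteq> parcs D1" "pverts D2 \<subseteq> (parcs D1)\<^sup>* `` X" "B2 \<subseteq> B1"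
    and dimaze2: "dimaze D2 B2"
  shows "comb_free D2 B2"
  unfolding comb_free_def
proof (intro allI impI)
  fix r A assume r: "ray D2 r" and A: "A \<subseteq> range r" "linkable D2 B2 A"
  have r1: "ray D1 r" using r sub(1) by (auto simp: ray_def)
  have r0: "r 0 \<in> pverts D2"
    using r dimaze2 pair_wf_digraph.in_arcsD1 unfolding ray_def dimaze_def pair_loopfree_digraph_def by metis
  have "linkable D1 B1 A"
  proof -
    obtain P2 where P2: "linkage D2 B2 P2" "hd ` P2 = A" using A by (auto simp: linkable_def)
    \<comment> \<open>\<open>X\<close> is not assumed to consist of vertices of \<open>D\<close>.
      Membership comes from being the tail of an arc of \<open>D1\<close> or, for the last vertex,
      from being in \<open>B1\<close>.\<close>
    have "set p \<subseteq> pverts D1" if "p \<in> P2" for p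
    proof -
      have p: "p \<noteq> []" "last p \<in> B1" "\<And>i. Suc i < length p \<Longrightarrow> (p ! i, p ! Suc i) \<in> parcs D1"
        using P2(1) that sub by (auto simp: linkage_def vpath_iff_nth)
      show ?thesis
      proof
        fix v assume "v \<in> set p"
        then obtain i where i: "i < length p" "v = p ! i" by (metis in_set_conv_nth)
        show "v \<in> pverts D1"
        proof (cases "Suc i < length p")
          case True
          then show ?thesis using p(3) arc_D1_tail m_in_verts i by fastforce
        next
          case False
          then have "v = last p" using i p(1) by (metis Suc_lessI diff_Suc_1 last_conv_nth)
          then show ?thesis using p(2) by (auto simp: B1_def)
        qed
      qed
    qed
    then have "linkage D1 B1 P2" using P2(1) sub by (auto simp: linkage_def vpath_iff_nth subset_iff)
    then show ?thesis using P2(2) by (auto simp: linkable_def)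
  qed
  then have link: "linkable D B0 A" by (rule linkable_of_shifted)
  have "finite (range r \<inter> Z)"
  proof (rule ccontr)
    assume inf: "infinite (range r \<inter> Z)"
    obtain x where x: "x \<in> X" "(x, r 0) \<in> (parcs D1)\<^sup>*" using r0 sub(2) by blast
    obtain r' where r': "ray D1 r'" "r' 0 = x" "finite (range r - range r')"
      using ray_from[OF x(2) r1] by auto
    have "range r \<inter> Z \<subseteq> (range r' \<inter> Z) \<union> (range r - range r')" by blast
    then have "infinite (range r' \<inter> Z)" using inf r'(3) by (meson finite_UnI finite_subset)
    then have "linkable D B0 (insert x (hd ` P))" using linkable_insert_ray_start r' by metis
    \<comment> \<open>The start of a ray of \<open>D1\<close> is the tail of an arc, hence a name
      \<open>m v\<close>, which a head of \<open>P\<close> is not.\<close>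
    moreover have "x \<notin> hd ` P"
      using r' heads_unmatched arc_D1_tail[of x "r' 1"] unfolding ray_def by (metis One_nat_def disjoint_iff)
    ultimately show False using max x(1) by blast
  qed
  then obtain N where N: "\<And>k. k \<ge> N \<Longrightarrow> r k \<notin> Z"
    using finite_range_Int_tail[of r] r1 by (metis ray_def)
  define q where "q k = r (k + N)" for k
  \<comment> \<open>Off \<open>Z\<close> the renaming is the identity, so an arc of
    \<open>D1\<close> with its tail there is an arc of \<open>D\<close>.\<close>
  have "(q k, q (Suc k)) \<in> parcs D" for k
  proof -
    have arc: "(q k, q (Suc k)) \<in> parcs D1" using r1 by (simp add: q_def ray_def)
    then obtain v where v: "v \<in> W" "q k = m v" using arc_D1_tail by blast
    have "q k \<notin> Z" using N by (simp add: q_def)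
    then have "m v = v" using m_off v by simp
    then show ?thesis using arc v arcs_D1 by metis
  qed
  then have q: "ray D q" using ray_tail[OF r1, of N] by (simp add: ray_def q_def[abs_def])
  have "A \<subseteq> (A \<inter> range q) \<union> r ` {..<N}"
  proof
    fix w assume "w \<in> A"
    then obtain k where k: "w = r k" using A(1) by blast
    show "w \<in> (A \<inter> range q) \<union> r ` {..<N}"
    proof (cases "k < N")
      case False
      then have "w = q (k - N)" using k by (simp add: q_def)
      then show ?thesis using \<open>w \<in> A\<close> by blast
    qed (use k in blast)
  qed
  moreover have "finite (A \<inter> range q)"
    using comb_free q linkable_subset[OF link] unfolding comb_free_def by (metis Int_lower1 Int_lower2)
  ultimately show "finite A" by (meson finite_UnI finite_imageI finite_lessThan finite_subset)
qed

end

text \<open>Members of \<open>S\<close> are exits and can be linked by trivial paths. Conversely,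
  each of them heads its own path in a linkage of \<open>I \<union> S\<close>, so the paths from
  \<open>I\<close> avoid \<open>S\<close>; they stay in \<open>U\<close> because no arc leaves
  \<open>U\<close>.\<close>

lemma linkable_induced_delete_exits:
  assumes dimaze: "dimaze D B0" and S: "S \<subseteq> B0 \<inter> U" and I: "I \<subseteq> U - S"
    and closed: "\<And>u v. u \<in> U \<Longrightarrow> (u, v) \<in> parcs D \<Longrightarrow> v \<in> U"
    and D': "D' = \<lparr>pverts = U - S, parcs = parcs D \<inter> (U - S) \<times> (U - S)\<rparr>" and U: "U \<subseteq> pverts D"
  shows "linkable D' (B0 \<inter> U - S) I \<longleftrightarrow> linkable D B0 (I \<union> S)"
proof
  assume "linkable D' (B0 \<inter> U - S) I"
  then obtain P where P: "linkage D' (B0 \<inter> U - S) P" "hd ` P = I" by (auto simp: linkable_def)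
  have P': "vpath p (with_proj D) \<and> last p \<in> B0 \<and> set p \<inter> S = {}" if "p \<in> P" for p
    using P(1) that U by (auto simp: linkage_def vpath_iff_nth D')
  have "vpath [s] (with_proj D)" if "s \<in> S" for s using that S U by (auto simp: vpath_iff_nth)
  then have "linkage D B0 (P \<union> (\<lambda>s. [s]) ` S)"
    unfolding linkage_def
  proof (intro conjI ballI impI)
    fix p assume p: "p \<in> P \<union> (\<lambda>s. [s]) ` S"
    then show "vpath p (with_proj D)" "last p \<in> B0"
      using P' S \<open>\<And>s. s \<in> S \<Longrightarrow> vpath [s] (with_proj D)\<close> by auto
    fix q assume q: "q \<in> P \<union> (\<lambda>s. [s]) ` S" "p \<noteq> q"
    have "set p' \<inter> set q' = {}" if "p' \<in> P" "q' \<in> P" "p' \<noteq> q'" for p' q'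
      using that P(1) by (simp add: linkage_def)
    moreover have "set p' \<inter> set [s] = {}" if "p' \<in> P" "s \<in> S" for p' s using P'[OF that(1)] that(2) by auto
    ultimately show "set p \<inter> set q = {}" using p q by (elim UnE imageE) (auto simp: Int_commute)
  qed
  moreover have "hd ` (P \<union> (\<lambda>s. [s]) ` S) = I \<union> S" using P(2) by (auto simp: image_Un image_image)
  ultimately show "linkable D B0 (I \<union> S)" unfolding linkable_def by blast
next
  assume "linkable D B0 (I \<union> S)"
  then obtain P where P: "linkage D B0 P" "hd ` P = I \<union> S" by (auto simp: linkable_def)
  define P' where "P' = {p \<in> P. hd p \<in> I}"
  have path: "vpath p (with_proj D)" "last p \<in> B0" if "p \<in> P" for p using P(1) that by (auto simp: linkage_def)
  have PU: "set p \<subseteq> U - S" if p: "p \<in> P'" for p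
  proof -
    have pP: "p \<in> P" "hd p \<in> I" using p by (auto simp: P'_def)
    have ne: "p \<noteq> []" using path[OF pP(1)] by (auto simp: vpath_iff_nth)
    have nth: "p ! i \<in> U" if "i < length p" for i
      using that
    proof (induction i)
      case 0
      then show ?case using pP(2) I ne by (auto simp: hd_conv_nth)
    next
      case (Suc i)
      then show ?case using closed path(1)[OF pP(1)] by (auto simp: vpath_iff_nth)
    qed
    have "s \<notin> set p" if s: "s \<in> S" for s
    proof
      assume "s \<in> set p"
      obtain p' where p': "p' \<in> P" "hd p' = s" using P(2) s by (metis UnCI imageE)
      then have "s \<in> set p'" using path(1) by (metis hd_in_set vpath_iff_nth)
      then have "p' = p" using \<open>s \<in> set p\<close> P(1) pP(1) p'(1) by (auto simp: linkage_def)
      then show False using p' s pP(2) I by blast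
    qed
    moreover have "set p \<subseteq> U" using nth by (auto simp: in_set_conv_nth)
    ultimately show ?thesis by blast
  qed
  have "vpath p (with_proj D') \<and> last p \<in> B0 \<inter> U - S" if p: "p \<in> P'" for p
  proof
    have pP: "p \<in> P" using p by (auto simp: P'_def)
    have ne: "p \<noteq> []" using path[OF pP] by (auto simp: vpath_iff_nth)
    then show "last p \<in> B0 \<inter> U - S" using PU[OF p] path(2)[OF pP] last_in_set by blast
    have "p ! i \<in> U - S" if "i < length p" for i using PU[OF p] that nth_mem by blast
    then show "vpath p (with_proj D')"
      using path(1)[OF pP] PU[OF p] by (auto simp: vpath_iff_nth D')
  qed
  then have "linkage D' (B0 \<inter> U - S) P'" using P(1) by (auto simp: linkage_def P'_def)
  moreover have "hd ` P' = I" using P(2) by (auto simp: P'_def)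
  ultimately show "linkable D' (B0 \<inter> U - S) I" unfolding linkable_def by blast
qed

text \<open>\<open>X\<close> is left open because two choices occur: all vertices, where the result
  has vertex set \<open>pverts D - S\<close>, and the ground set of a matroid that is a restriction
  of \<open>M_L D B0\<close>.\<close>

lemma contract_maximal_linkable:
  assumes "dimaze D B0" "comb_free D B0" "X \<subseteq> pverts D" "linkable D B0 B" "B \<subseteq> X" "S \<subseteq> B"
    and max: "\<And>x. x \<in> X - B \<Longrightarrow> \<not> linkable D B0 (insert x B)"
  obtains D' B0' where "dimaze D' B0'" "comb_free D' B0'" "X - S \<subseteq> pverts D'" "pverts D' \<subseteq> pverts D - S"
    "\<And>I. I \<subseteq> X - S \<Longrightarrow> linkable D' B0' I \<longleftrightarrow> linkable D B0 (I \<union> S)"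
proof -
  obtain P where P: "linkage D B0 P" "hd ` P = B" using assms(4) by (auto simp: linkable_def)
  obtain m where m: "matching_fun D B0 m" "follows m (pverts D - B0) B0 (\<Union>p\<in>P. set p)"
    "hd ` P \<inter> m ` (pverts D - B0) = {}"
    using matching_fun_of_linkage[OF assms(1) P(1)] .
  interpret shifted_dimaze D B0 P m
    using assms(1,2) P(1) m by unfold_locales
  \<comment> \<open>No arc of \<open>D1\<close> leaves \<open>U\<close>, so no path from
    \<open>X\<close> is lost, and every vertex of \<open>U\<close> is reachable from
    \<open>X\<close>, as \<open>comb_free_shifted\<close> requires.\<close>
  define U where "U = (parcs D1)\<^sup>* `` X"
  define D' where "D' = \<lparr>pverts = U - S, parcs = parcs D1 \<inter> (U - S) \<times> (U - S)\<rparr>"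
  define B0' where "B0' = B1 \<inter> U - S"
  have U: "X \<subseteq> U" "U \<subseteq> pverts D"
  proof -
    show "X \<subseteq> U" by (auto simp: U_def)
    show "U \<subseteq> pverts D"
    proof
      fix u assume "u \<in> U"
      then obtain x where x: "x \<in> X" "(x, u) \<in> (parcs D1)\<^sup>*" by (auto simp: U_def)
      have "v \<in> pverts D" if "(y, v) \<in> parcs D1" for y v using that wf by (auto simp: D1_def)
      with x(2) show "u \<in> pverts D" using x(1) assms(3) by (cases rule: rtranclE) auto
    qed
  qed
  have closed: "v \<in> U" if "u \<in> U" "(u, v) \<in> parcs D1" for u v
    using that by (auto simp: U_def intro: rtrancl_into_rtrancl)
  have S: "S \<subseteq> B1 \<inter> U" using assms(5,6) U heads_subset_B1 P(2) by blast
  have dim: "dimaze D' B0'"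
    using dimaze_D1 unfolding dimaze_def pair_loopfree_digraph_def pair_loopfree_digraph_axioms_def
      pair_wf_digraph_def by (auto simp: D'_def B0'_def)
  have max': "\<not> linkable D B0 (insert x (hd ` P))" if "x \<in> X - hd ` P" for x
    using max that P(2) by simp
  have "comb_free D' B0'"
    by (rule comb_free_shifted[OF max' _ _ _ dim]) (auto simp: D'_def B0'_def U_def)
  moreover have "linkable D' B0' I \<longleftrightarrow> linkable D B0 (I \<union> S)" if I: "I \<subseteq> X - S" for I
  proof -
    have "I \<subseteq> U - S" using I U by blast
    then have "linkable D' B0' I \<longleftrightarrow> linkable D1 B1 (I \<union> S)"
      unfolding B0'_def
      using linkable_induced_delete_exits[OF dimaze_D1 S _ closed D'_def] U(2) by simp
    also have "\<dots> \<longleftrightarrow> linkable D B0 (I \<union> S)"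
    proof
      assume link: "linkable D B0 (I \<union> S)"
      have "I \<union> S \<subseteq> X" using I assms(5,6) by blast
      then show "linkable D1 B1 (I \<union> S)" using linkable_shifted[OF link] max' by blast
    qed (rule linkable_of_shifted)
    finally show ?thesis .
  qed
  ultimately show ?thesis using that[of D' B0'] dim U by (auto simp: D'_def)
qed

section \<open>Minors of infinite matroids\<close>

lemma maximal_in_iff_insert:
  assumes "\<And>I J. I \<in> F \<Longrightarrow> J \<subseteq> I \<Longrightarrow> J \<in> F"
  shows "maximal_in F I \<longleftrightarrow> I \<in> F \<and> (\<forall>x. insert x I \<in> F \<longrightarrow> x \<in> I)"
proof
  assume "maximal_in F I"
  then show "I \<in> F \<and> (\<forall>x. insert x I \<in> F \<longrightarrow> x \<in> I)" unfolding maximal_in_def by blast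
next
  assume I: "I \<in> F \<and> (\<forall>x. insert x I \<in> F \<longrightarrow> x \<in> I)"
  have "J = I" if J: "J \<in> F" "I \<subseteq> J" for J
  proof
    show "J \<subseteq> I"
    proof
      fix x assume "x \<in> J"
      then have "insert x I \<in> F" using assms[OF J(1), of "insert x I"] J(2) by blast
      then show "x \<in> I" using I by blast
    qed
  qed (rule J(2))
  then show "maximal_in F I" using I unfolding maximal_in_def by blast
qed

lemma maximal_inD: "maximal_in F I \<Longrightarrow> J \<in> F \<Longrightarrow> I \<subseteq> J \<Longrightarrow> J = I"
  by (simp add: maximal_in_def)

lemma matroidI:
  assumes "\<And>I. I \<in> F \<Longrightarrow> I \<subseteq> E" "{} \<in> F" "\<And>I J. I \<in> F \<Longrightarrow> J \<subseteq> I \<Longrightarrow> J \<in> F"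
    and "\<And>I I'. I \<in> F \<Longrightarrow> \<not> maximal_in F I \<Longrightarrow> maximal_in F I' \<Longrightarrow> \<exists>x\<in>I' - I. insert x I \<in> F"
    and "\<And>I X. I \<in> F \<Longrightarrow> I \<subseteq> X \<Longrightarrow> X \<subseteq> E \<Longrightarrow> \<exists>J. maximal_in {I' \<in> F. I \<subseteq> I' \<and> I' \<subseteq> X} J"
  shows "matroid (E, F)"
proof -
  have "F \<subseteq> Pow E" using assms(1) by blast
  moreover have "\<forall>I\<in>F. \<forall>J. J \<subseteq> I \<longrightarrow> J \<in> F" using assms(3) by blast
  moreover have "\<forall>I I'. I \<in> F \<and> \<not> maximal_in F I \<and> maximal_in F I' \<longrightarrow> (\<exists>x\<in>I' - I. insert x I \<in> F)"
    using assms(4) by simp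
  moreover have "\<forall>I X. I \<in> F \<and> I \<subseteq> X \<and> X \<subseteq> E \<longrightarrow> (\<exists>J. maximal_in {I' \<in> F. I \<subseteq> I' \<and> I' \<subseteq> X} J)"
    using assms(5) by simp
  ultimately show ?thesis using assms(2) unfolding matroid_def fst_conv snd_conv by (intro conjI)
qed

locale infinite_matroid =
  fixes M :: "'a indep_system"
  assumes matroid: "matroid M"
begin

lemma empty_indep: "{} \<in> indeps M"
  and indep_ground: "I \<in> indeps M \<Longrightarrow> I \<subseteq> ground M"
  and indep_subset: "I \<in> indeps M \<Longrightarrow> J \<subseteq> I \<Longrightarrow> J \<in> indeps M"
  and nonmaximal_exchange: "I \<in> indeps M \<Longrightarrow> \<not> maximal_in (indeps M) I \<Longrightarrow>
    maximal_in (indeps M) I' \<Longrightarrow> \<exists>x\<in>I' - I. insert x I \<in> indeps M"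
  and maximal_between: "I \<in> indeps M \<Longrightarrow> I \<subseteq> X \<Longrightarrow> X \<subseteq> ground M \<Longrightarrow>
    \<exists>J. maximal_in {I' \<in> indeps M. I \<subseteq> I' \<and> I' \<subseteq> X} J"
  using matroid unfolding matroid_def by simp_all auto

lemma base_iff: "B \<in> bases M \<longleftrightarrow> B \<in> indeps M \<and> (\<forall>x. insert x B \<in> indeps M \<longrightarrow> x \<in> B)"
  using maximal_in_iff_insert[of "indeps M" B] indep_subset by (auto simp: bases_def)

lemma base_exchange:
  assumes "insert y I \<in> indeps M" "y \<notin> I" "B \<in> bases M"
  obtains x where "x \<in> B" "x \<notin> I" "insert x I \<in> indeps M"
proof -
  have I: "I \<in> indeps M" using assms(1) indep_subset by blast
  have "\<not> maximal_in (indeps M) I" using assms(1,2) unfolding maximal_in_def by blast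
  then have "\<exists>x\<in>B - I. insert x I \<in> indeps M"
    using nonmaximal_exchange I assms(3) unfolding bases_def by blast
  then show ?thesis using that by blast
qed

lemma extend_within:
  assumes "I \<in> indeps M" "I \<subseteq> X" "X \<subseteq> ground M"
  obtains J where "J \<in> indeps M" "I \<subseteq> J" "J \<subseteq> X" "\<And>x. x \<in> X \<Longrightarrow> insert x J \<in> indeps M \<Longrightarrow> x \<in> J"
proof -
  obtain J where J: "maximal_in {I' \<in> indeps M. I \<subseteq> I' \<and> I' \<subseteq> X} J"
    using maximal_between[OF assms] by blast
  show ?thesis
  proof (rule that)
    show "J \<in> indeps M" "I \<subseteq> J" "J \<subseteq> X" using J by (auto simp: maximal_in_def)
    fix x assume "x \<in> X" "insert x J \<in> indeps M"
    then have "insert x J = J" using J unfolding maximal_in_def by blast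
    then show "x \<in> J" by blast
  qed
qed

lemma extend_to_base:
  assumes "I \<in> indeps M"
  obtains B where "B \<in> bases M" "I \<subseteq> B"
proof -
  obtain B where B: "B \<in> indeps M" "I \<subseteq> B" "\<And>x. x \<in> ground M \<Longrightarrow> insert x B \<in> indeps M \<Longrightarrow> x \<in> B"
    using extend_within[OF assms indep_ground[OF assms] order_refl] by metis
  then have "B \<in> bases M" unfolding base_iff using indep_ground by blast
  then show ?thesis using that B(2) by blast
qed

text \<open>A set that is maximal within \<open>insert y B\<close> is a base: otherwise exchange
  against \<open>B\<close> would add an element of \<open>B\<close> to it.\<close>

lemma extend_near_base:
  assumes "I \<in> indeps M" "I \<subseteq> insert y B" "B \<in> bases M" "y \<in> ground M"
  obtains J where "J \<in> bases M" "I \<subseteq> J" "J \<subseteq> insert y B"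
proof -
  have "insert y B \<subseteq> ground M" using assms(3,4) indep_ground base_iff by blast
  then obtain J where J: "J \<in> indeps M" "I \<subseteq> J" "J \<subseteq> insert y B"
      "\<And>x. x \<in> insert y B \<Longrightarrow> insert x J \<in> indeps M \<Longrightarrow> x \<in> J"
    using extend_within[OF assms(1,2)] by metis
  have "J \<in> bases M" unfolding base_iff
  proof (intro conjI allI impI)
    fix x assume x: "insert x J \<in> indeps M"
    show "x \<in> J"
    proof (rule ccontr)
      assume "x \<notin> J"
      with x obtain z where "z \<in> B" "z \<notin> J" "insert z J \<in> indeps M" using base_exchange assms(3) by metis
      then show False using J(4) by blast
    qed
  qed (rule J(1))
  then show ?thesis using that J(2,3) by blast
qed

text \<open>This is (I3) for the restriction to \<open>X\<close>. The set \<open>I'\<close> is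
  extended to a base \<open>B\<close>, which meets \<open>X\<close> in \<open>I'\<close> only, and
  \<open>I\<close> is filled up from \<open>B - X\<close> to \<open>B2\<close>. If \<open>B2\<close>
  is no base, exchange against \<open>B\<close> adds an element that cannot come from
  \<open>B - X\<close>, so it lies in \<open>I'\<close>.\<close>

lemma restriction_exchange:
  assumes y: "insert y I \<in> indeps M" "y \<notin> I" "insert y I \<subseteq> X" and X: "X \<subseteq> ground M"
    and I': "I' \<in> indeps M" "I' \<subseteq> X" "\<And>x. x \<in> X \<Longrightarrow> insert x I' \<in> indeps M \<Longrightarrow> x \<in> I'"
  shows "\<exists>x\<in>I' - I. insert x I \<in> indeps M"
proof -
  have I: "I \<in> indeps M" "I \<subseteq> X" using y indep_subset by blast+
  obtain B where B: "B \<in> bases M" "I' \<subseteq> B" using extend_to_base[OF I'(1)] .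
  have BX: "x \<in> I'" if "x \<in> B" "x \<in> X" for x
  proof (rule I'(3)[OF that(2)])
    show "insert x I' \<in> indeps M"
      using B that(1) indep_subset[of B "insert x I'"] base_iff by blast
  qed
  have "I \<union> (B - X) \<subseteq> ground M" using I X B(1) base_iff indep_ground by blast
  then obtain B2 where B2: "B2 \<in> indeps M" "I \<subseteq> B2" "B2 \<subseteq> I \<union> (B - X)"
      "\<And>x. x \<in> I \<union> (B - X) \<Longrightarrow> insert x B2 \<in> indeps M \<Longrightarrow> x \<in> B2"
    using extend_within[OF I(1)] by (metis sup_ge1)
  show ?thesis
  proof (cases "B2 \<in> bases M")
    case False
    then obtain u where "insert u B2 \<in> indeps M" "u \<notin> B2" using B2(1) base_iff by blast
    then obtain x where x: "x \<in> B" "x \<notin> B2" "insert x B2 \<in> indeps M"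
      using base_exchange B(1) by metis
    then have "x \<in> X" using B2(4) by blast
    moreover have "insert x I \<in> indeps M" by (rule indep_subset[OF x(3)]) (use B2(2) in blast)
    ultimately show ?thesis using BX x(1,2) B2(2) by blast
  next
    \<comment> \<open>This case is contradictory: adding \<open>y\<close> pushes some
      \<open>z\<close> of \<open>B - X\<close> out of the base. Replacing \<open>z\<close> in
      \<open>B\<close> then adds an element \<open>x\<close> of \<open>X\<close> outside
      \<open>B\<close>, and \<open>insert x I'\<close> is independent, against the maximality of
      \<open>I'\<close>.\<close>
    case B2base: True
    have yB2: "y \<notin> B2" "insert y I \<subseteq> insert y B2" using y(2,3) B2(2,3) by blast+
    have "y \<in> ground M" using y(3) X by blast
    then obtain J where J: "J \<in> bases M" "insert y I \<subseteq> J" "J \<subseteq> insert y B2"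
      using extend_near_base[OF y(1) yB2(2) B2base] by blast
    have "insert y B2 \<notin> indeps M" using B2base yB2(1) base_iff by blast
    then have "J \<noteq> insert y B2" using J(1) base_iff by blast
    then obtain z where z: "z \<in> B2" "z \<notin> J" using J(2,3) by blast
    then have zB: "z \<in> B" "z \<notin> X" using B2(3) J(2) by blast+
    have "insert z (B - {z}) \<in> indeps M" using B(1) zB(1) base_iff by (simp add: insert_absorb)
    then obtain x where x: "x \<in> J" "x \<notin> B - {z}" "insert x (B - {z}) \<in> indeps M"
      using base_exchange[of z "B - {z}" J] J(1) by blast
    have xB: "x \<notin> B" using x z by blast
    have xX: "x \<in> X" using x(1) J(3) B2(3) xB y(3) by blast
    have "insert x I' \<in> indeps M" by (rule indep_subset[OF x(3)]) (use B(2) I'(2) zB(2) in blast)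
    then have "x \<in> I'" using I'(3) xX by blast
    then show ?thesis using B(2) xB by blast
  qed
qed

lemma matroid_restriction:
  assumes X: "X \<subseteq> ground M"
  shows "matroid (restriction M X)"
proof -
  define F where "F = {I \<in> indeps M. I \<subseteq> X}"
  have down: "\<And>I J. I \<in> F \<Longrightarrow> J \<subseteq> I \<Longrightarrow> J \<in> F" unfolding F_def using indep_subset by blast
  have "\<exists>x\<in>I' - I. insert x I \<in> F" if "I \<in> F" "\<not> maximal_in F I" "maximal_in F I'" for I I'
  proof -
    have nonmax: "\<exists>y. insert y I \<in> F \<and> y \<notin> I" using that(1,2) maximal_in_iff_insert[of F I] down by blast
    then obtain y where y: "insert y I \<in> indeps M" "insert y I \<subseteq> X" "y \<notin> I" by (auto simp: F_def)
    have I': "I' \<in> F" "\<And>x. insert x I' \<in> F \<Longrightarrow> x \<in> I'"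
      using that(3) maximal_in_iff_insert[of F I'] down by blast+
    have "\<exists>x\<in>I' - I. insert x I \<in> indeps M"
    proof (rule restriction_exchange[OF y(1,3,2) X])
      show "I' \<in> indeps M" "I' \<subseteq> X" using I'(1) by (auto simp: F_def)
      fix x assume "x \<in> X" "insert x I' \<in> indeps M"
      then show "x \<in> I'" using I'(1) I'(2)[of x] by (simp add: F_def)
    qed
    then show ?thesis using I'(1) y(2) unfolding F_def by blast
  qed
  moreover have "\<exists>J. maximal_in {I' \<in> F. I \<subseteq> I' \<and> I' \<subseteq> Y} J" if "I \<in> F" "I \<subseteq> Y" "Y \<subseteq> X" for I Y
  proof -
    have "{I' \<in> F. I \<subseteq> I' \<and> I' \<subseteq> Y} = {I' \<in> indeps M. I \<subseteq> I' \<and> I' \<subseteq> Y}"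
      using that(3) unfolding F_def by blast
    moreover have "I \<in> indeps M" "Y \<subseteq> ground M" using that X by (auto simp: F_def)
    ultimately show ?thesis using maximal_between that(2) by simp
  qed
  moreover have "{} \<in> F" using empty_indep by (simp add: F_def)
  moreover have "I \<subseteq> X" if "I \<in> F" for I using that by (simp add: F_def)
  ultimately show ?thesis
    unfolding restriction_def F_def[symmetric] using down by (intro matroidI)
qed

text \<open>Independence over \<open>C\<close> does not depend on the maximal independent subset of
  \<open>C\<close> that is used. \<open>T\<close> extends \<open>S\<close> within
  \<open>J \<union> S\<close> and is compared with \<open>J \<union> S0\<close>, which is maximal in
  \<open>J \<union> C\<close>. If \<open>T\<close> is not maximal there, exchange enlarges
  \<open>T\<close> by an element of \<open>J\<close> or of \<open>S0\<close>, against the choice of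
  \<open>T\<close> or of \<open>S\<close>.\<close>

lemma indep_Un_swap:
  assumes "J \<union> S0 \<in> indeps M" "J \<inter> C = {}" "S \<in> indeps M" and C: "C \<subseteq> ground M"
    and S0: "S0 \<subseteq> C" "\<And>x. x \<in> C \<Longrightarrow> insert x S0 \<in> indeps M \<Longrightarrow> x \<in> S0"
    and S: "S \<subseteq> C" "\<And>x. x \<in> C \<Longrightarrow> insert x S \<in> indeps M \<Longrightarrow> x \<in> S"
  shows "J \<union> S \<in> indeps M"
proof -
  have J: "J \<subseteq> ground M" using indep_ground[OF assms(1)] by blast
  have ground: "J \<union> C \<subseteq> ground M" "J \<union> S \<subseteq> ground M" using J C S(1) by blast+
  obtain T where T: "T \<in> indeps M" "S \<subseteq> T" "T \<subseteq> J \<union> S"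
      "\<And>x. x \<in> J \<union> S \<Longrightarrow> insert x T \<in> indeps M \<Longrightarrow> x \<in> T"
    using extend_within[OF assms(3) _ ground(2)] by (metis sup_ge2)
  have "J \<subseteq> T"
  proof (rule ccontr)
    assume "\<not> J \<subseteq> T"
    then obtain j where j: "j \<in> J" "j \<notin> T" by blast
    show False
    proof (cases "\<exists>y. insert y T \<in> indeps M \<and> y \<notin> T \<and> insert y T \<subseteq> J \<union> C")
      case True
      then obtain y where y: "insert y T \<in> indeps M" "y \<notin> T" "insert y T \<subseteq> J \<union> C" by blast
      have "\<exists>x\<in>(J \<union> S0) - T. insert x T \<in> indeps M"
      proof (rule restriction_exchange[OF y ground(1) assms(1)])
        fix x assume x: "x \<in> J \<union> C" "insert x (J \<union> S0) \<in> indeps M"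
        have "insert x S0 \<in> indeps M" by (rule indep_subset[OF x(2)]) blast
        then show "x \<in> J \<union> S0" using x(1) S0(2) by blast
      qed (use S0(1) in blast)
      then obtain x where x: "x \<in> J \<union> S0" "x \<notin> T" "insert x T \<in> indeps M" by blast
      have "insert x S \<in> indeps M" by (rule indep_subset[OF x(3)]) (use T(2) in blast)
      then show False using x T(2,4) S(2) S0(1) by blast
    next
      case False
      \<comment> \<open>Now \<open>T\<close> is maximal in \<open>J \<union> C\<close>, and
        \<open>j\<close> shows that \<open>(T \<inter> J) \<union> S0\<close> is not. Exchange
        against \<open>T\<close> adds an element of \<open>C\<close>, against the maximality of
        \<open>S0\<close>.\<close>
      have jS0: "insert j ((T \<inter> J) \<union> S0) \<in> indeps M" by (rule indep_subset[OF assms(1)]) (use j(1) in blast)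
      have "\<exists>x\<in>T - ((T \<inter> J) \<union> S0). insert x ((T \<inter> J) \<union> S0) \<in> indeps M"
      proof (rule restriction_exchange[OF jS0 _ _ ground(1) T(1)])
        show "j \<notin> T \<inter> J \<union> S0" using j assms(2) S0(1) by blast
        show "insert j (T \<inter> J \<union> S0) \<subseteq> J \<union> C" using j S0(1) by blast
        show TJC: "T \<subseteq> J \<union> C" using T(3) S(1) by blast
        fix x assume "x \<in> J \<union> C" "insert x T \<in> indeps M"
        then show "x \<in> T" using False TJC by blast
      qed
      then obtain x where x: "x \<in> T" "x \<notin> T \<inter> J \<union> S0" "insert x ((T \<inter> J) \<union> S0) \<in> indeps M" by blast
      have "x \<in> C" using x T(3) S(1) by blast
      moreover have "insert x S0 \<in> indeps M" by (rule indep_subset[OF x(3)]) blast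
      ultimately show False using S0(2) x(2) by blast
    qed
  qed
  then have "J \<union> S = T" using T(2,3) by blast
  then show ?thesis using T(1) by simp
qed

text \<open>A maximal \<open>K\<close> in the restricted dual is \<open>E - C - B\<close> for a base
  \<open>B\<close> with \<open>B \<inter> C\<close> maximal independent in \<open>C\<close>, and
  \<open>indep_Un_swap\<close> replaces \<open>B \<inter> C\<close> by \<open>S\<close>.\<close>

lemma contraction_eq:
  assumes C: "C \<subseteq> ground M" and S: "S \<in> indeps M" "S \<subseteq> C" "\<And>x. x \<in> C \<Longrightarrow> insert x S \<in> indeps M \<Longrightarrow> x \<in> S"
  shows "contraction M C = (ground M - C, {J. J \<subseteq> ground M - C \<and> J \<union> S \<in> indeps M})"
proof -
  define E where "E = ground M"
  define F where "F = {I. (\<exists>B\<in>bases M. I \<subseteq> E - B) \<and> I \<subseteq> E - C}"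
  have con: "contraction M C = (E - C, {J. \<exists>K. maximal_in F K \<and> J \<subseteq> E - C - K})"
  proof -
    have "deletion (dual M) C = (E - C, F)"
      unfolding deletion_def restriction_def dual_def F_def E_def fst_conv snd_conv by simp
    then show ?thesis by (simp add: contraction_def dual_def[of "(E - C, F)"] bases_def[of "(E - C, F)"])
  qed
  have "J \<union> S \<in> indeps M" if K: "maximal_in F K" "J \<subseteq> E - C - K" for J K
  proof -
    obtain B where B: "B \<in> bases M" "K \<subseteq> E - B" "K \<subseteq> E - C" using K(1) by (auto simp: maximal_in_def F_def)
    have Bi: "B \<in> indeps M" using B(1) base_iff by blast
    have inF: "E - C - B' \<in> F" if "B' \<in> bases M" for B' using that unfolding F_def by blast
    have KB: "K = E - C - B" using maximal_inD[OF K(1) inF[OF B(1)]] B(2,3) by blast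
    show ?thesis
    proof (rule indep_Un_swap[OF _ _ S(1) C _ _ S(2,3)])
      show "J \<union> B \<inter> C \<in> indeps M" by (rule indep_subset[OF Bi]) (use K(2) KB in blast)
      show "J \<inter> C = {}" "B \<inter> C \<subseteq> C" using K(2) by blast+
      fix x assume x: "x \<in> C" "insert x (B \<inter> C) \<in> indeps M"
      have "x \<in> ground M" using x(1) C by blast
      \<comment> \<open>Since \<open>x\<close> lies in \<open>C\<close>, the base \<open>B'\<close>
        misses all of \<open>K\<close>; maximality of \<open>K\<close> forces it to contain
        \<open>B - C\<close> too, so \<open>insert x B\<close> is independent.\<close>
      then obtain B' where B': "B' \<in> bases M" "insert x (B \<inter> C) \<subseteq> B'" "B' \<subseteq> insert x B"
        using extend_near_base[OF x(2) _ B(1)] by blast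
      have "K \<subseteq> E - C - B'" using B'(3) KB x(1) by blast
      then have "E - C - B' = K" by (rule maximal_inD[OF K(1) inF[OF B'(1)]])
      then have "B - C \<subseteq> B'" using KB indep_ground[OF Bi] unfolding E_def by blast
      then have "insert x B \<subseteq> B'" using B'(2) by blast
      moreover have "B' \<in> indeps M" using B'(1) base_iff by blast
      ultimately have "insert x B \<in> indeps M" by (rule indep_subset[rotated])
      then show "x \<in> B \<inter> C" using B(1) base_iff x(1) by blast
    qed
  qed
  moreover have "\<exists>K. maximal_in F K \<and> J \<subseteq> E - C - K" if J: "J \<subseteq> E - C" "J \<union> S \<in> indeps M" for J
  proof -
    obtain B where B: "B \<in> bases M" "J \<union> S \<subseteq> B" using extend_to_base[OF J(2)] .
    have Bi: "B \<in> indeps M" using B(1) base_iff by blast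
    define K where "K = E - C - B"
    have "K' = K" if K': "K' \<in> F" "K \<subseteq> K'" for K'
    proof (rule ccontr)
      assume "K' \<noteq> K"
      then obtain x where x: "x \<in> K'" "x \<notin> K" using K'(2) by blast
      obtain B' where B': "B' \<in> bases M" "K' \<subseteq> E - B'" "K' \<subseteq> E - C" using K'(1) unfolding F_def by blast
      \<comment> \<open>A larger \<open>K'\<close> misses a base \<open>B'\<close> and contains some
        \<open>x\<close> of \<open>B - C\<close>. Replacing \<open>x\<close> in \<open>B\<close> by
        an element \<open>y\<close> of \<open>B'\<close> cannot use \<open>C\<close>, as
        \<open>S\<close> is maximal there, so \<open>y\<close> lies in \<open>K\<close> and also in
        \<open>B'\<close>.\<close>
      have xB: "x \<in> B" "x \<notin> C" "x \<notin> B'" using x B' unfolding K_def by blast+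
      have "insert x (B - {x}) \<in> indeps M" using Bi xB(1) by (simp add: insert_absorb)
      then obtain y where y: "y \<in> B'" "y \<notin> B - {x}" "insert y (B - {x}) \<in> indeps M"
        using base_exchange[of x "B - {x}" B'] B'(1) by blast
      have yB: "y \<notin> B" using y xB by blast
      have "y \<notin> C"
      proof
        assume "y \<in> C"
        moreover have "insert y S \<in> indeps M" by (rule indep_subset[OF y(3)]) (use B(2) S(2) xB(2) in blast)
        ultimately show False using S(3) B(2) yB by blast
      qed
      then have "y \<in> K" using yB indep_ground[OF y(3)] unfolding K_def E_def by blast
      then show False using K'(2) B'(2) y(1) by blast
    qed
    moreover have "K \<in> F" using B(1) unfolding F_def K_def by blast
    ultimately have "maximal_in F K" unfolding maximal_in_def by blast
    moreover have "J \<subseteq> E - C - K" using J(1) B(2) unfolding K_def by blast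
    ultimately show ?thesis by blast
  qed
  ultimately have "{J. \<exists>K. maximal_in F K \<and> J \<subseteq> E - C - K} = {J. J \<subseteq> E - C \<and> J \<union> S \<in> indeps M}" by blast
  then show ?thesis using con by (simp add: E_def)
qed

text \<open>Each axiom is that of \<open>M\<close> for sets joined with \<open>S\<close>. A maximal
  member joined with \<open>S\<close> is a base of \<open>M\<close>, because no element of
  \<open>C - S\<close> can be added to \<open>S\<close>.\<close>

lemma matroid_contract_indep:
  assumes C: "C \<subseteq> ground M" and S: "S \<in> indeps M" "S \<subseteq> C" "\<And>x. x \<in> C \<Longrightarrow> insert x S \<in> indeps M \<Longrightarrow> x \<in> S"
  shows "matroid (ground M - C, {J. J \<subseteq> ground M - C \<and> J \<union> S \<in> indeps M})"
proof -
  define F where "F = {J. J \<subseteq> ground M - C \<and> J \<union> S \<in> indeps M}"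
  have down: "J \<in> F" if "I \<in> F" "J \<subseteq> I" for I J
    using that indep_subset[of "I \<union> S" "J \<union> S"] unfolding F_def by blast
  have "\<exists>x\<in>I' - I. insert x I \<in> F" if "I \<in> F" "\<not> maximal_in F I" "maximal_in F I'" for I I'
  proof -
    have nonmax: "\<exists>y. insert y I \<in> F \<and> y \<notin> I" using that(1,2) maximal_in_iff_insert[of F I] down by blast
    then obtain y where y: "insert y (I \<union> S) \<in> indeps M" "y \<notin> I \<union> S" using S(2) by (auto simp: F_def)
    have I': "I' \<in> F" "\<And>x. insert x I' \<in> F \<Longrightarrow> x \<in> I'"
      using that(3) maximal_in_iff_insert[of F I'] down by blast+
    have "I' \<union> S \<in> bases M" unfolding base_iff
    proof (intro conjI allI impI)
      show "I' \<union> S \<in> indeps M" using I'(1) by (simp add: F_def)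
      fix x assume x: "insert x (I' \<union> S) \<in> indeps M"
      show "x \<in> I' \<union> S"
      proof (cases "x \<in> C")
        case True
        have "insert x S \<in> indeps M" by (rule indep_subset[OF x]) blast
        then show ?thesis using S(3) True by blast
      next
        case False
        then have "insert x I' \<in> F" using x I'(1) indep_ground[OF x] by (simp add: F_def)
        then show ?thesis using I'(2) by blast
      qed
    qed
    then obtain x where x: "x \<in> I' \<union> S" "x \<notin> I \<union> S" "insert x (I \<union> S) \<in> indeps M"
      using base_exchange[OF y] by blast
    then have "insert x I \<in> F" using that(1) I'(1) by (auto simp: F_def)
    then show ?thesis using x by blast
  qed
  moreover have "\<exists>J. maximal_in {I' \<in> F. I \<subseteq> I' \<and> I' \<subseteq> Y} J" if I: "I \<in> F" "I \<subseteq> Y" "Y \<subseteq> ground M - C" for I Y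
  proof -
    have "I \<union> S \<in> indeps M" "I \<union> S \<subseteq> Y \<union> S" "Y \<union> S \<subseteq> ground M"
      using I C S(2) unfolding F_def by blast+
    then obtain J where J: "J \<in> indeps M" "I \<union> S \<subseteq> J" "J \<subseteq> Y \<union> S"
        "\<And>x. x \<in> Y \<union> S \<Longrightarrow> insert x J \<in> indeps M \<Longrightarrow> x \<in> J" using extend_within by metis
    have JS: "(J - S) \<union> S = J" using J(2) by blast
    have "J - S \<in> {I' \<in> F. I \<subseteq> I' \<and> I' \<subseteq> Y}" using J JS I S(2) unfolding F_def by auto
    moreover have "J' = J - S" if J': "J' \<in> F" "I \<subseteq> J'" "J' \<subseteq> Y" "J - S \<subseteq> J'" for J'
    proof -
      have "x \<in> J" if "x \<in> J'" for x
      proof (rule J(4))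
        show "x \<in> Y \<union> S" using that J'(3) by blast
        have "J' \<union> S \<in> indeps M" using J'(1) by (simp add: F_def)
        then show "insert x J \<in> indeps M" using indep_subset[of "J' \<union> S" "insert x J"] that J'(4) by blast
      qed
      moreover have "J' \<inter> S = {}" using J'(1) S(2) unfolding F_def by blast
      ultimately show ?thesis using J'(4) by blast
    qed
    ultimately show ?thesis unfolding maximal_in_def by blast
  qed
  moreover have "{} \<in> F" using S(1) by (simp add: F_def)
  moreover have "I \<subseteq> ground M - C" if "I \<in> F" for I using that by (simp add: F_def)
  ultimately show ?thesis
    unfolding F_def[symmetric] using down by (intro matroidI)
qed

end

section \<open>Minors of gammoids\<close>

lemma linkable_in_verts: "linkable D B0 A \<Longrightarrow> A \<subseteq> pverts D"
  by (fastforce simp: linkable_def linkage_def vpath_iff_nth)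

text \<open>Elements of \<open>C - S\<close> become loops once \<open>S\<close> is contracted. So it
  suffices to contract an independent set and then restrict to \<open>Y\<close>.\<close>

lemma minor_eq:
  assumes "matroid M" "is_minor N M"
  obtains C S Y where "C \<subseteq> ground M" "S \<in> indeps M" "S \<subseteq> C"
    "\<forall>x\<in>C. insert x S \<in> indeps M \<longrightarrow> x \<in> S"
    "Y \<subseteq> ground M - C" "N = (Y, {J. J \<subseteq> Y \<and> J \<union> S \<in> indeps M})"
proof -
  interpret infinite_matroid M by unfold_locales (rule assms(1))
  obtain C R where C: "C \<subseteq> ground M" and N: "N = deletion (contraction M C) R"
    using assms(2) unfolding is_minor_def by blast
  obtain S where S: "S \<in> indeps M" "S \<subseteq> C" "\<forall>x\<in>C. insert x S \<in> indeps M \<longrightarrow> x \<in> S"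
    using extend_within[OF empty_indep empty_subsetI C] by metis
  have "N = (ground M - C - R, {J. J \<subseteq> ground M - C - R \<and> J \<union> S \<in> indeps M})"
  proof -
    have "contraction M C = (ground M - C, {J. J \<subseteq> ground M - C \<and> J \<union> S \<in> indeps M})"
      using contraction_eq[OF C S(1,2)] S(3) by blast
    then show ?thesis unfolding N by (auto simp: deletion_def restriction_def)
  qed
  then show ?thesis by (rule that[OF C S, rotated]) blast
qed

text \<open>The new dimaze has to define a matroid on all its vertices. So \<open>S\<close> is
  extended to a base of the whole strict gammoid instead of a base of \<open>M\<close>, and the new
  dimaze presents the contraction of \<open>M_L D B0\<close> by \<open>S\<close>.\<close>

lemma CO_free_gammoid_minor:
  assumes minor: "is_minor N M" and M: "CO_free_gammoid M"
  shows "CO_free_gammoid N"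
proof -
  obtain D B0 where pres: "presentation D B0 M" and strict: "strict_gammoid (M_L D B0)" and "CO_free D B0"
    using M by (auto simp: CO_free_gammoid_def)
  then obtain X where D: "dimaze D B0" and X: "X \<subseteq> pverts D" "M = restriction (M_L D B0) X"
    by (auto simp: presentation_def)
  have free: "comb_free D B0" by (rule comb_free_of_CO_free) fact+
  interpret L: infinite_matroid "M_L D B0" using strict by unfold_locales (simp add: strict_gammoid_def)
  have gr: "ground (M_L D B0) = pverts D" by (simp add: M_L_def)
  have indep: "I \<in> indeps (M_L D B0) \<longleftrightarrow> linkable D B0 I" for I
    using linkable_in_verts by (auto simp: M_L_def)
  have "matroid M" using L.matroid_restriction X gr by simp
  obtain C S Y where C: "C \<subseteq> ground M" and S: "S \<in> indeps M" "S \<subseteq> C"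
    and S_max: "\<forall>x\<in>C. insert x S \<in> indeps M \<longrightarrow> x \<in> S"
    and Y: "Y \<subseteq> ground M - C" and N: "N = (Y, {J. J \<subseteq> Y \<and> J \<union> S \<in> indeps M})"
    using minor_eq[OF \<open>matroid M\<close> minor] .
  have M_indep: "I \<in> indeps M \<longleftrightarrow> I \<subseteq> X \<and> linkable D B0 I" and M_ground: "ground M = X" for I
    using X(2) indep by (auto simp: restriction_def)
  have "S \<in> indeps (M_L D B0)" using S(1) M_indep indep by simp
  then obtain B where B: "B \<in> bases (M_L D B0)" "S \<subseteq> B" using L.extend_to_base by blast
  then have B_max: "linkable D B0 B" "\<And>x. x \<in> pverts D - B \<Longrightarrow> \<not> linkable D B0 (insert x B)"
    using L.base_iff indep by blast+
  obtain D' B0' where D': "dimaze D' B0'" "comb_free D' B0'" "pverts D - S \<subseteq> pverts D'" "pverts D' \<subseteq> pverts D - S"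
    and lk: "\<And>I. I \<subseteq> pverts D - S \<Longrightarrow> linkable D' B0' I \<longleftrightarrow> linkable D B0 (I \<union> S)"
    using contract_maximal_linkable[OF D free order_refl B_max(1) linkable_in_verts[OF B_max(1)] B(2) B_max(2)]
    by metis
  have M_L': "M_L D' B0' = (pverts D - S, {J. J \<subseteq> pverts D - S \<and> J \<union> S \<in> indeps (M_L D B0)})"
    using D'(3,4) lk indep by (auto simp: M_L_def)
  \<comment> \<open>With \<open>C\<close> taken to be \<open>S\<close>, the maximality of
    \<open>S\<close> within \<open>C\<close> is trivial.\<close>
  have "matroid (M_L D' B0')"
    unfolding M_L' using L.matroid_contract_indep[of S S] gr indep M_indep S(1) X(1) by auto
  moreover have "indep_system_iso (M_L D' B0') (M_L D' B0')"
    unfolding indep_system_iso_def by (intro exI[of _ id]) simp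
  ultimately have strict': "strict_gammoid (M_L D' B0')"
    using D'(1) unfolding strict_gammoid_def by blast
  have Y': "Y \<subseteq> pverts D - S" using Y M_ground X(1) S(2) by blast
  have N': "N = restriction (M_L D' B0') Y"
  proof -
    have "J \<subseteq> Y \<Longrightarrow> J \<union> S \<in> indeps M \<longleftrightarrow> J \<union> S \<in> indeps (M_L D B0)" for J
      using Y C S(2) M_ground M_indep indep by blast
    then show ?thesis unfolding N M_L' restriction_def using Y' by auto
  qed
  have "Y \<subseteq> ground (M_L D' B0')" using Y' M_L' by simp
  then have "gammoid N" using strict' N' unfolding gammoid_def by blast
  moreover have "presentation D' B0' N"
    using D'(1,3) Y' N' unfolding presentation_def by blast
  ultimately show ?thesis
    using strict' CO_free_of_comb_free[OF D'(2)] unfolding CO_free_gammoid_def by blast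
qed

text \<open>\<open>M_L D B0\<close> may have no base above \<open>S\<close>, so \<open>B\<close> is
  a base of \<open>M\<close>, maximal only within \<open>X\<close>. That \<open>N\<close> is a
  matroid comes from contracting and restricting \<open>M\<close> itself.\<close>

lemma CO_free_presentable_matroid_minor:
  assumes minor: "is_minor N M" and M: "CO_free_presentable_matroid M"
  shows "CO_free_presentable_matroid N"
proof -
  obtain D B0 where "matroid M" and pres: "presentation D B0 M" and "CO_free D B0"
    using M by (auto simp: CO_free_presentable_matroid_def)
  then obtain X where D: "dimaze D B0" and X: "X \<subseteq> pverts D" "M = restriction (M_L D B0) X"
    by (auto simp: presentation_def)
  have free: "comb_free D B0" by (rule comb_free_of_CO_free) fact+
  interpret infinite_matroid M by unfold_locales fact
  obtain C S Y where C: "C \<subseteq> ground M" and S: "S \<in> indeps M" "S \<subseteq> C"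
    and S_max: "\<forall>x\<in>C. insert x S \<in> indeps M \<longrightarrow> x \<in> S"
    and Y: "Y \<subseteq> ground M - C" and N: "N = (Y, {J. J \<subseteq> Y \<and> J \<union> S \<in> indeps M})"
    using minor_eq[OF \<open>matroid M\<close> minor] .
  have M_indep: "I \<in> indeps M \<longleftrightarrow> I \<subseteq> X \<and> linkable D B0 I" and M_ground: "ground M = X" for I
    using X linkable_in_verts[of D B0 I] by (auto simp: restriction_def M_L_def)
  obtain B where B: "B \<in> bases M" "S \<subseteq> B" using extend_to_base[OF S(1)] .
  then have B_max: "linkable D B0 B" "B \<subseteq> X" "\<And>x. x \<in> X - B \<Longrightarrow> \<not> linkable D B0 (insert x B)"
    using base_iff M_indep by blast+
  obtain D' B0' where D': "dimaze D' B0'" "comb_free D' B0'" "X - S \<subseteq> pverts D'"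
    and lk: "\<And>I. I \<subseteq> X - S \<Longrightarrow> linkable D' B0' I \<longleftrightarrow> linkable D B0 (I \<union> S)"
    using contract_maximal_linkable[OF D free X(1) B_max(1,2) B(2) B_max(3)] by metis
  have YX: "Y \<subseteq> X - S" using Y M_ground S(2) by blast
  have SX: "S \<subseteq> X" using S(1) M_indep by blast
  have "J \<union> S \<in> indeps M \<longleftrightarrow> J \<subseteq> pverts D' \<and> linkable D' B0' J" if "J \<subseteq> Y" for J
    using lk[of J] that YX SX D'(3) M_indep[of "J \<union> S"] by blast
  then have N': "N = restriction (M_L D' B0') Y"
    unfolding N restriction_def M_L_def by auto
  have con: "matroid (ground M - C, {J. J \<subseteq> ground M - C \<and> J \<union> S \<in> indeps M})" (is "matroid ?M'")
    by (rule matroid_contract_indep[OF C S S_max[rule_format]])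
  have "N = restriction ?M' Y" unfolding N restriction_def using Y by auto
  then have "matroid N"
    using infinite_matroid.matroid_restriction[of ?M' Y] con Y by (simp add: infinite_matroid_def)
  moreover have "presentation D' B0' N"
    using D'(1,3) YX N' unfolding presentation_def by blast
  ultimately show ?thesis
    using CO_free_of_comb_free[OF D'(2)] unfolding CO_free_presentable_matroid_def by blast
qed

theorem theorem2p11:
  fixes M N :: "'v indep_system"
  assumes "is_minor N M"
  shows "(CO_free_gammoid M \<longrightarrow> CO_free_gammoid N) \<and>
         (CO_free_presentable_matroid M \<longrightarrow> CO_free_presentable_matroid N)"
  using CO_free_gammoid_minor CO_free_presentable_matroid_minor assms by blast

end
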